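(* Let $n\ge 2$, let $(k_1,\alpha_1),\dots,(k_n,\alpha_n)$ be an admissible sequence and let $\Sigma_n\in\mathbb{R}^{n\times n}$ be the asymptotic covariance matrix in the supercritical regime. Then: (i) $\mathrm{rank}(\Sigma_n)=1$; (ii) $\det(\Sigma_n)=0$; (iii) $\Sigma_n$ is positive semidefinite, but not positive definite.
   Context: Fix $d\ge 1$ and let $B^d\subset\mathbb{R}^d$ be the unit ball. For $s>0$ and points $x_0,\dots,x_k\in\mathbb{R}^d$ with $k\le d$, $\Delta_s[x_0,\dots,x_k]$ is the $k$-dimensional volume of the convex hull of $x_0,\dots,x_k$ if all edge lengths $\|x_i-x_j\|$ are at most $s$, and $0$ otherwise; for $k>d$ the volume is replaced by $1$. Powers $\Delta_s[\cdot]^\alpha$ are understood to be $0$ when some edge length exceeds $s$. The list $\{x_l\}_{l=i}^j$ stands for $x_i,\dots,x_j$ (empty if $j<i$). Define $$\mu_{k_1,k_2:m}^{(\alpha_1,\alpha_2)}=\int_{(B^d)^{k_1+k_2+1-m}}\Delta_1[0,\{x_l\}_{l=1}^{k_1}]^{\alpha_1}\,\Delta_1[0,\{x_l\}_{l=k_1-m+2}^{k_1+k_2-m+1}]^{\alpha_2}\,dx_1\cdots dx_{k_1+k_2+1-m}.$$ A sequence $(k_1,\alpha_1),\dots,(k_n,\alpha_n)$ (with $k_i$ integers, $\alpha_i$ real) is admissible if: $0\le k_1\le\dots\le k_n$; the pairs are distinct; $\alpha_i>-d+k_i-1$ and $\alpha_i+\alpha_j>-d+\min_{l\in\{i,j\}}k_l-1$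 for all $i,j$; and $\alpha_i=0$ if $k_i>d$. In the supercritical regime ($t\delta_t^d\to\infty$) the asymptotic covariance matrix of the normalized vector of volume power functionals $(\tilde{\mathcal V}_{k_1}^{(\alpha_1)},\dots,\tilde{\mathcal V}_{k_n}^{(\alpha_n)})$ is $$\Sigma_n=\Big(\frac{\mu_{k_i,k_j:1}^{(\alpha_i,\alpha_j)}}{k_i!\,k_j!}\Big)_{i,j=1,\dots,n}.$$ *)

theory Defs
  imports "HOL-Analysis.Analysis"
begin

text \<open>
  The \<open>k\<close>-dimensional volume of a set \<open>S\<close> lying in a \<open>k\<close>-dimensional affine subspace of \<open>'a\<close>: the
  Lebesgue measure of \<open>S\<close> in Cartesian coordinates of such a subspace (origin \<open>p\<close>, orthonormal
  axes \<open>e 0, \<dots>, e (k - 1)\<close>), where the coordinate space of dimension \<open>k\<close> is the product measure over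
  the index set \<open>{..<k}\<close>. The value does not depend on the choice of \<open>p\<close> and \<open>e\<close>. For \<open>k = 0\<close> a
  point gets volume 1.
\<close>

definition orthonormal_frame :: "nat \<Rightarrow> (nat \<Rightarrow> 'a::euclidean_space) \<Rightarrow> bool" where
  "orthonormal_frame k e \<longleftrightarrow> (\<forall>i<k. \<forall>j<k. e i \<bullet> e j = (if i = j then 1 else 0))"

definition frame_point :: "nat \<Rightarrow> 'a::euclidean_space \<Rightarrow> (nat \<Rightarrow> 'a) \<Rightarrow> (nat \<Rightarrow> real) \<Rightarrow> 'a" where
  "frame_point k p e c = p + (\<Sum>i<k. c i *\<^sub>R e i)"

definition flat_volume :: "nat \<Rightarrow> 'a::euclidean_space set \<Rightarrow> real" where
  "flat_volume k S =
    (SOME v. \<exists>p e. orthonormal_frame k e \<and> S \<subseteq> range (frame_point k p e) \<and>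
       v = measure (\<Pi>\<^sub>M i\<in>{..<k}. lborel)
             {c \<in> {..<k} \<rightarrow>\<^sub>E UNIV. frame_point k p e c \<in> S})"

definition edges_le :: "real \<Rightarrow> 'a::euclidean_space list \<Rightarrow> bool" where
  "edges_le s xs \<longleftrightarrow> (\<forall>x\<in>set xs. \<forall>y\<in>set xs. norm (x - y) \<le> s)"

text \<open>A list \<open>xs = [x\<^sub>0, \<dots>, x\<^sub>k]\<close> has length \<open>k + 1\<close>.\<close>

definition simplex_Delta :: "real \<Rightarrow> 'a::euclidean_space list \<Rightarrow> real" where
  "simplex_Delta s xs =
    (if edges_le s xs
     then (if length xs - 1 \<le> DIM('a) then flat_volume (length xs - 1) (convex hull (set xs)) else 1)
     else 0)"

text \<open>
  The power \<open>\<Delta>\<^sub>s[xs]\<^sup>\<alpha>\<close>, which is 0 if some edge is longer than \<open>s\<close>, even for \<open>\<alpha> \<le> 0\<close>. The case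
  \<open>\<alpha> = 0\<close> is separate because \<open>0 powr 0 = 0\<close>. For \<open>\<alpha> < 0\<close> the value at degenerate simplices,
  which form a null set, is 0 instead of infinity.
\<close>

definition simplex_Delta_power :: "real \<Rightarrow> real \<Rightarrow> 'a::euclidean_space list \<Rightarrow> real" where
  "simplex_Delta_power s \<alpha> xs =
    (if edges_le s xs then (if \<alpha> = 0 then 1 else simplex_Delta s xs powr \<alpha>) else 0)"

text \<open>
  \<open>\<mu>\<close> with indices \<open>k\<^sub>1, k\<^sub>2 : m\<close> and exponents \<open>\<alpha>\<^sub>1, \<alpha>\<^sub>2\<close>, for \<open>m \<le> min k\<^sub>1 k\<^sub>2 + 1\<close> (so that the
  subtractions do not truncate); the type argument is the space \<open>\<real>\<^sup>d\<close>.
\<close>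

definition mu ::
  "'a::euclidean_space itself \<Rightarrow> nat \<Rightarrow> nat \<Rightarrow> nat \<Rightarrow> real \<Rightarrow> real \<Rightarrow> real" where
  "mu _ k1 k2 m \<alpha>1 \<alpha>2 =
    (LINT x : ({1..k1 + k2 + 1 - m} \<rightarrow>\<^sub>E cball (0::'a) 1) | (\<Pi>\<^sub>M l\<in>{1..k1 + k2 + 1 - m}. lborel).
       simplex_Delta_power 1 \<alpha>1 (0 # map x [1..<k1 + 1]) *
       simplex_Delta_power 1 \<alpha>2 (0 # map x [k1 + 2 - m..<k1 + k2 + 2 - m]))"

text \<open>The index set \<open>{1, \<dots>, n}\<close> is a finite linearly ordered type \<open>'n\<close> with \<open>n = CARD('n)\<close>.\<close>

definition admissible :: "nat \<Rightarrow> ('n::{finite,linorder} \<Rightarrow> nat) \<Rightarrow> ('n \<Rightarrow> real) \<Rightarrow> bool" where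
  "admissible d k \<alpha> \<longleftrightarrow>
     mono k \<and>
     inj (\<lambda>i. (k i, \<alpha> i)) \<and>
     (\<forall>i. \<alpha> i > - real d + real (k i) - 1) \<and>
     (\<forall>i j. \<alpha> i + \<alpha> j > - real d + real (min (k i) (k j)) - 1) \<and>
     (\<forall>i. k i > d \<longrightarrow> \<alpha> i = 0)"

definition supercritical_cov ::
  "'a::euclidean_space itself \<Rightarrow> ('n::{finite,linorder} \<Rightarrow> nat) \<Rightarrow> ('n \<Rightarrow> real) \<Rightarrow> real^'n::{finite,linorder}^'n::{finite,linorder}" where
  "supercritical_cov T k \<alpha> =
     (\<chi> i j. mu T (k i) (k j) 1 (\<alpha> i) (\<alpha> j) / (fact (k i) * fact (k j)))"

definition positive_semidefinite :: "real^'n^'n \<Rightarrow> bool" where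
  "positive_semidefinite A \<longleftrightarrow> transpose A = A \<and> (\<forall>x. x \<bullet> (A *v x) \<ge> 0)"

definition positive_definite :: "real^'n^'n \<Rightarrow> bool" where
  "positive_definite A \<longleftrightarrow> transpose A = A \<and> (\<forall>x. x \<noteq> 0 \<longrightarrow> x \<bullet> (A *v x) > 0)"

end

theory Submission
  imports Defs
begin

text \<open>
  For \<open>m = 1\<close> the two simplices in \<open>\<mu>\<close> share only the origin, so by Fubini \<open>\<mu>\<close> is a product
  \<open>I(k\<^sub>1, \<alpha>\<^sub>1) I(k\<^sub>2, \<alpha>\<^sub>2)\<close> and the covariance matrix is \<open>a a\<^sup>T\<close> with \<open>a\<^sub>i = I(k\<^sub>i, \<alpha>\<^sub>i) / k\<^sub>i!\<close>. It remains
  to see that \<open>0 < I(k, \<alpha>) < \<infinity>\<close>. By Gram-Schmidt the volume of the simplex is \<open>1 / k!\<close> times the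
  product of the distances \<open>r\<^sub>j\<close> of \<open>x\<^sub>j\<close> from the span of the preceding points, and
  \<open>r\<^sub>j\<^sup>\<alpha>\<close> is integrable over the ball, uniformly in that span, because it has codimension at least
  \<open>d - k + 1 > -\<alpha>\<close>.
\<close>

section \<open>Lebesgue measure on coordinate spaces and spans\<close>

text \<open>\<open>flat_volume\<close> chooses an origin and a frame by \<open>SOME\<close>, so its
  value on a simplex is known only once all eligible choices are shown to agree; for a degenerate
  simplex the eligible frames even span different subspaces. Translation invariance and Fubini
  settle this without determinants. They also yield the passage from an arbitrary basis to an
  orthonormal one, a coordinate at a time, and with it the volume formula. The bound \<alpha> > -d +
  k - 1 is the integrability condition of the last point, whose predecessors span at most k - 1
  dimensions; earlier points see a larger codimension. Positivity of I(k, \<alpha>) is not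
  automatic: \<open>0 powr \<alpha>\<close> is 0, so for \<alpha> \<noteq> 0 degenerate simplices
  have weight 0 and must be shown to be negligible. A singular integral of the same kind provides
  this. Positivity and finiteness are both at stake because \<open>enn2real\<close> sends 0 and
  infinity alike to 0.\<close>

lemma PiM_lborel_reindex:
  assumes "bij_betw h I J" "finite I"
  shows "distr (\<Pi>\<^sub>M j\<in>J. lborel) (\<Pi>\<^sub>M i\<in>I. lborel) (\<lambda>x. \<lambda>i\<in>I. x (h i)) =
         (\<Pi>\<^sub>M i\<in>I. (lborel :: 'b::euclidean_space measure))" (is "distr ?J ?I ?T = _")
proof -
  interpret product_sigma_finite "\<lambda>_. lborel :: 'b measure" by standard
  have J: "finite J" "J = h ` I" "inj_on h I"
    using assms bij_betw_finite by (auto simp: bij_betw_def)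
  have T[measurable]: "?T \<in> measurable ?J ?I"
    using J by (intro measurable_restrict measurable_component_singleton) auto
  show ?thesis
  proof (rule PiM_eqI)
    fix A assume A: "\<And>i. i \<in> I \<Longrightarrow> A i \<in> sets (lborel :: 'b measure)"
    have "?T -` Pi\<^sub>E I A \<inter> space ?J = Pi\<^sub>E J (\<lambda>j. A (the_inv_into I h j))"
      using J by (auto simp: space_PiM PiE_iff the_inv_into_f_f)
    then have "emeasure (distr ?J ?I ?T) (Pi\<^sub>E I A) = emeasure ?J (Pi\<^sub>E J (\<lambda>j. A (the_inv_into I h j)))"
      using A assms(2) by (subst emeasure_distr[OF T]) (auto intro!: sets_PiM_I_finite)
    also have "\<dots> = (\<Prod>j\<in>J. emeasure lborel (A (the_inv_into I h j)))"
      using A J by (intro emeasure_PiM) (auto simp: the_inv_into_f_f)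
    also have "\<dots> = (\<Prod>i\<in>I. emeasure lborel (A i))"
      unfolding J(2) using J(3) by (simp add: prod.reindex the_inv_into_f_f cong: prod.cong)
    finally show "emeasure (distr ?J ?I ?T) (Pi\<^sub>E I A) = (\<Prod>i\<in>I. emeasure lborel (A i))" .
  qed (use assms in auto)
qed

text \<open>Coordinates come with several index sets: \<open>Basis\<close> for Lebesgue measure on
  the whole space, the blocks \<open>{1..k1}\<close> and \<open>{k1 + 1..k1 + k2}\<close> in
  \<open>mu\<close>. This transports integrals over all of them to \<open>{..<k}\<close>.\<close>

lemma nn_integral_PiM_lborel_reindex:
  assumes "bij_betw h I J" "finite I"
    and f: "f \<in> borel_measurable (\<Pi>\<^sub>M i\<in>I. (lborel :: 'b::euclidean_space measure))"
  shows "(\<integral>\<^sup>+x. f (\<lambda>i\<in>I. x (h i)) \<partial>(\<Pi>\<^sub>M j\<in>J. (lborel :: 'b measure))) = (\<integral>\<^sup>+x. f x \<partial>(\<Pi>\<^sub>M i\<in>I. lborel))"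
proof -
  have J: "h i \<in> J" if "i \<in> I" for i
    using assms(1) that by (auto simp: bij_betw_def)
  have "(\<integral>\<^sup>+x. f x \<partial>(\<Pi>\<^sub>M i\<in>I. lborel)) =
      (\<integral>\<^sup>+x. f x \<partial>distr (\<Pi>\<^sub>M j\<in>J. lborel) (\<Pi>\<^sub>M i\<in>I. lborel) (\<lambda>x. \<lambda>i\<in>I. x (h i)))"
    by (simp only: PiM_lborel_reindex[OF assms(1,2)])
  also have "\<dots> = (\<integral>\<^sup>+x. f (\<lambda>i\<in>I. x (h i)) \<partial>(\<Pi>\<^sub>M j\<in>J. lborel))"
  proof (rule nn_integral_distr)
    show "(\<lambda>x. \<lambda>i\<in>I. x (h i)) \<in> (\<Pi>\<^sub>M j\<in>J. (lborel :: 'b measure)) \<rightarrow>\<^sub>M (\<Pi>\<^sub>M i\<in>I. lborel)"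
      by (intro measurable_restrict measurable_component_singleton J)
  qed (simp add: f)
  finally show ?thesis ..
qed

lemma PiM_lborel_translate:
  assumes "finite I"
  shows "distr (\<Pi>\<^sub>M i\<in>I. lborel) (\<Pi>\<^sub>M i\<in>I. lborel) (\<lambda>x. \<lambda>i\<in>I. a i + x i) =
         (\<Pi>\<^sub>M i\<in>I. (lborel :: 'b::euclidean_space measure))" (is "distr ?I _ ?T = _")
proof -
  interpret product_sigma_finite "\<lambda>_. lborel :: 'b measure" by standard
  have T[measurable]: "?T \<in> measurable ?I ?I"
    by measurable
  show ?thesis
  proof (rule PiM_eqI)
    fix A assume A: "\<And>i. i \<in> I \<Longrightarrow> A i \<in> sets (lborel :: 'b measure)"
    have m: "(+) (a i) -` A i \<in> sets (lborel :: 'b measure)" if "i \<in> I" for i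
      using measurable_sets_borel[of "(+) (a i)" borel "A i"] A[OF that] by simp
    have "?T -` Pi\<^sub>E I A \<inter> space ?I = Pi\<^sub>E I (\<lambda>i. (+) (a i) -` A i)"
      by (auto simp: space_PiM PiE_iff)
    then have "emeasure (distr ?I ?I ?T) (Pi\<^sub>E I A) = emeasure ?I (Pi\<^sub>E I (\<lambda>i. (+) (a i) -` A i))"
      using A assms by (subst emeasure_distr[OF T]) (auto intro!: sets_PiM_I_finite)
    also have "\<dots> = (\<Prod>i\<in>I. emeasure lborel ((+) (a i) -` A i))"
      using m assms by (intro emeasure_PiM) auto
    also have "\<dots> = (\<Prod>i\<in>I. emeasure lborel (A i))"
    proof (rule prod.cong)
      fix i assume "i \<in> I"
      have "emeasure lborel (A i) = emeasure (distr lborel borel ((+) (a i))) (A i)"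
        by (simp add: lborel_distr_plus)
      also have "\<dots> = emeasure lborel ((+) (a i) -` A i)"
        using A[OF \<open>i \<in> I\<close>] by (subst emeasure_distr) auto
      finally show "emeasure lborel ((+) (a i) -` A i) = emeasure lborel (A i)" ..
    qed simp
    finally show "emeasure (distr ?I ?I ?T) (Pi\<^sub>E I A) = (\<Prod>i\<in>I. emeasure lborel (A i))" .
  qed (use assms in auto)
qed

lemma nn_integral_PiM_lborel_translate:
  assumes "finite I"
    and f: "f \<in> borel_measurable (\<Pi>\<^sub>M i\<in>I. (lborel :: 'b::euclidean_space measure))"
  shows "(\<integral>\<^sup>+x. f (\<lambda>i\<in>I. a i + x i) \<partial>(\<Pi>\<^sub>M i\<in>I. (lborel :: 'b measure))) = (\<integral>\<^sup>+x. f x \<partial>(\<Pi>\<^sub>M i\<in>I. lborel))"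
  by (subst (2) PiM_lborel_translate[OF assms(1), of a, symmetric])
     (simp add: nn_integral_distr f)

section \<open>Integration over a span through coefficients\<close>

abbreviation lborel_fun :: "nat \<Rightarrow> (nat \<Rightarrow> 'b::euclidean_space) measure" where
  "lborel_fun k \<equiv> (\<Pi>\<^sub>M i\<in>{..<k}. lborel)"

abbreviation lin_comb :: "nat \<Rightarrow> (nat \<Rightarrow> 'a::euclidean_space) \<Rightarrow> (nat \<Rightarrow> real) \<Rightarrow> 'a" where
  "lin_comb k u c \<equiv> \<Sum>i<k. c i *\<^sub>R u i"

lemma sigma_finite_lborel_fun:
  "sigma_finite_measure (lborel_fun k :: (nat \<Rightarrow> 'b::euclidean_space) measure)"
proof -
  interpret finite_product_sigma_finite "\<lambda>_. lborel :: 'b measure" "{..<k}"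
    by standard auto
  show ?thesis by (rule sigma_finite_measure_axioms)
qed

lemma lin_comb_in_span: "lin_comb k u c \<in> span (u ` {..<k})"
  by (intro span_sum span_scale span_base) auto

lemma span_eq_lin_comb: "v \<in> span (u ` {..<k}) \<longleftrightarrow> (\<exists>c. v = lin_comb k u c)"
proof
  assume "v \<in> span (u ` {..<k})"
  then show "\<exists>c. v = lin_comb k u c"
  proof (induction k arbitrary: v)
    case (Suc k)
    then obtain a where "v - a *\<^sub>R u k \<in> span (u ` {..<k})"
      by (auto simp: lessThan_Suc span_insert)
    then obtain c where "v - a *\<^sub>R u k = lin_comb k u c"
      using Suc.IH by blast
    then have "v = lin_comb (Suc k) u (c(k := a))"
      by (auto simp: algebra_simps intro!: sum.cong)
    then show ?case by blast
  qed auto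
qed (auto simp: lin_comb_in_span)

text \<open>A vector of the span has some coefficients \<open>a\<close>, and adding it amounts to
  the translation by \<open>a\<close> in the coefficient space.\<close>

lemma nn_integral_lin_comb_translate:
  fixes f :: "'a::euclidean_space \<Rightarrow> ennreal"
  assumes "v \<in> span (u ` {..<k})" and [measurable]: "f \<in> borel_measurable borel"
  shows "(\<integral>\<^sup>+c. f (v + lin_comb k u c) \<partial>lborel_fun k) = (\<integral>\<^sup>+c. f (lin_comb k u c) \<partial>lborel_fun k)"
proof -
  obtain a where v: "v = lin_comb k u a"
    using assms(1) span_eq_lin_comb by blast
  have "(\<integral>\<^sup>+c. f (lin_comb k u c) \<partial>lborel_fun k) =
        (\<integral>\<^sup>+c. f (lin_comb k u (\<lambda>i\<in>{..<k}. a i + c i)) \<partial>lborel_fun k)"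
    by (subst nn_integral_PiM_lborel_translate[of _ "\<lambda>c. f (lin_comb k u c)"]) auto
  also have "\<dots> = (\<integral>\<^sup>+c. f (v + lin_comb k u c) \<partial>lborel_fun k)"
    by (simp add: v scaleR_add_left sum.distrib)
  finally show ?thesis ..
qed

text \<open>
  Uniqueness of Haar measure on the span: comparing two translation-invariant measures through
  \<open>\<integral>\<integral> g(x) f(y) = \<integral>\<integral> g(x) f(x + y) = \<integral>\<integral> g(x - y) f(x)\<close>.
\<close>

lemma nn_integral_lin_comb_unique:
  fixes u w :: "nat \<Rightarrow> 'a::euclidean_space" and f g :: "'a \<Rightarrow> ennreal"
  assumes span: "span (u ` {..<k}) = span (w ` {..<l})"
    and f[measurable]: "f \<in> borel_measurable borel" and g[measurable]: "g \<in> borel_measurable borel"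
    and even: "\<And>x. g (- x) = g x"
  shows "(\<integral>\<^sup>+c. g (lin_comb k u c) \<partial>lborel_fun k) * (\<integral>\<^sup>+c. f (lin_comb l w c) \<partial>lborel_fun l) =
         (\<integral>\<^sup>+c. f (lin_comb k u c) \<partial>lborel_fun k) * (\<integral>\<^sup>+c. g (lin_comb l w c) \<partial>lborel_fun l)"
proof -
  interpret U: sigma_finite_measure "lborel_fun k :: (nat \<Rightarrow> real) measure" by (rule sigma_finite_lborel_fun)
  interpret W: sigma_finite_measure "lborel_fun l :: (nat \<Rightarrow> real) measure" by (rule sigma_finite_lborel_fun)
  interpret pair_sigma_finite "lborel_fun k :: (nat \<Rightarrow> real) measure" "lborel_fun l :: (nat \<Rightarrow> real) measure" ..
  have in_w: "lin_comb k u c \<in> span (w ` {..<l})" for c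
    using lin_comb_in_span[where u=u and c=c and k=k] span by simp
  have in_u: "- lin_comb l w c \<in> span (u ` {..<k})" for c
    using lin_comb_in_span[where u=w and c=c and k=l] span by (simp add: span_neg)
  have "(\<integral>\<^sup>+c. g (lin_comb k u c) \<partial>lborel_fun k) * (\<integral>\<^sup>+c. f (lin_comb l w c) \<partial>lborel_fun l) =
        (\<integral>\<^sup>+c. (\<integral>\<^sup>+b. g (lin_comb k u c) * f (lin_comb l w b) \<partial>lborel_fun l) \<partial>lborel_fun k)"
    by (simp add: nn_integral_cmult nn_integral_multc)
  also have "\<dots> = (\<integral>\<^sup>+c. (\<integral>\<^sup>+b. g (lin_comb k u c) * f (lin_comb k u c + lin_comb l w b) \<partial>lborel_fun l) \<partial>lborel_fun k)"
  proof (rule nn_integral_cong)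
    fix c show "(\<integral>\<^sup>+b. g (lin_comb k u c) * f (lin_comb l w b) \<partial>lborel_fun l) =
      (\<integral>\<^sup>+b. g (lin_comb k u c) * f (lin_comb k u c + lin_comb l w b) \<partial>lborel_fun l)"
      using nn_integral_lin_comb_translate[OF in_w, where f = "\<lambda>y. g (lin_comb k u c) * f y", of c]
      by simp
  qed
  also have "\<dots> = (\<integral>\<^sup>+b. (\<integral>\<^sup>+c. g (lin_comb k u c) * f (lin_comb k u c + lin_comb l w b) \<partial>lborel_fun k) \<partial>lborel_fun l)"
    by (intro Fubini'[symmetric]) measurable
  also have "\<dots> = (\<integral>\<^sup>+b. (\<integral>\<^sup>+c. g (- lin_comb l w b + lin_comb k u c) * f (lin_comb k u c) \<partial>lborel_fun k) \<partial>lborel_fun l)"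
  proof (rule nn_integral_cong)
    fix b show "(\<integral>\<^sup>+c. g (lin_comb k u c) * f (lin_comb k u c + lin_comb l w b) \<partial>lborel_fun k) =
      (\<integral>\<^sup>+c. g (- lin_comb l w b + lin_comb k u c) * f (lin_comb k u c) \<partial>lborel_fun k)"
      using nn_integral_lin_comb_translate[OF in_u, where f = "\<lambda>y. g y * f (y + lin_comb l w b)", of b]
      by (simp add: algebra_simps)
  qed
  also have "\<dots> = (\<integral>\<^sup>+c. (\<integral>\<^sup>+b. g (- lin_comb l w b + lin_comb k u c) * f (lin_comb k u c) \<partial>lborel_fun l) \<partial>lborel_fun k)"
    by (intro Fubini') measurable
  \<comment> \<open>Evenness of \<open>g\<close> reverses the sign of its argument. The inner
    integral then runs over a translate by \<open>- lin_comb k u c\<close>, a vector of the common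
    span, which translation invariance removes.\<close>
  also have "\<dots> = (\<integral>\<^sup>+c. (\<integral>\<^sup>+b. f (lin_comb k u c) * g (- lin_comb k u c + lin_comb l w b) \<partial>lborel_fun l) \<partial>lborel_fun k)"
    by (intro nn_integral_cong, subst even[symmetric]) (simp add: algebra_simps)
  also have "\<dots> = (\<integral>\<^sup>+c. (\<integral>\<^sup>+b. f (lin_comb k u c) * g (lin_comb l w b) \<partial>lborel_fun l) \<partial>lborel_fun k)"
  proof (rule nn_integral_cong)
    fix c show "(\<integral>\<^sup>+b. f (lin_comb k u c) * g (- lin_comb k u c + lin_comb l w b) \<partial>lborel_fun l) =
      (\<integral>\<^sup>+b. f (lin_comb k u c) * g (lin_comb l w b) \<partial>lborel_fun l)"
      using nn_integral_lin_comb_translate[OF span_neg[OF in_w], where f = "\<lambda>y. f (lin_comb k u c) * g y", of c]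
      by simp
  qed
  also have "\<dots> = (\<integral>\<^sup>+c. f (lin_comb k u c) \<partial>lborel_fun k) * (\<integral>\<^sup>+c. g (lin_comb l w c) \<partial>lborel_fun l)"
    by (simp add: nn_integral_cmult nn_integral_multc)
  finally show ?thesis .
qed

lemma norm_lin_comb_frame:
  assumes "orthonormal_frame k e"
  shows "norm (lin_comb k e c) ^ 2 = (\<Sum>i<k. c i ^ 2)"
proof -
  have "norm (lin_comb k e c) ^ 2 = (\<Sum>i<k. \<Sum>j<k. c j * (c i * (e j \<bullet> e i)))"
    by (simp add: power2_norm_eq_inner inner_sum_left inner_sum_right sum_distrib_left algebra_simps)
  also have "\<dots> = (\<Sum>i<k. \<Sum>j<k. if j = i then c i ^ 2 else 0)"
    using assms by (intro sum.cong refl) (auto simp: orthonormal_frame_def power2_eq_square)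
  finally show ?thesis by simp
qed

text \<open>The uniqueness identity is applied with \<open>g\<close> the indicator of the unit ball.
  Orthonormal coordinates are isometric, so its integral is the volume \<open>S\<close> of the
  Euclidean unit ball of coefficients for both frames, and it cancels once it is known to be
  positive and finite.\<close>

lemma nn_integral_frame_unique:
  fixes f :: "'a::euclidean_space \<Rightarrow> ennreal"
  assumes "orthonormal_frame k e" "orthonormal_frame k e'"
    and span: "span (e ` {..<k}) = span (e' ` {..<k})"
    and f[measurable]: "f \<in> borel_measurable borel"
  shows "(\<integral>\<^sup>+c. f (lin_comb k e c) \<partial>lborel_fun k) = (\<integral>\<^sup>+c. f (lin_comb k e' c) \<partial>lborel_fun k)"
proof -
  interpret product_sigma_finite "\<lambda>_. lborel :: real measure" by standard
  define g where "g = (indicator (cball 0 1) :: 'a \<Rightarrow> ennreal)"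
  have [measurable]: "g \<in> borel_measurable borel" unfolding g_def by (intro borel_measurable_indicator) auto
  define m where "m e = (\<integral>\<^sup>+c. g (lin_comb k e c) \<partial>lborel_fun k)" for e :: "nat \<Rightarrow> 'a"
  define S where "S = {c \<in> space (lborel_fun k). (\<Sum>i<k. c i ^ 2) \<le> (1::real)}"
  have S[measurable]: "S \<in> sets (lborel_fun k)"
    unfolding S_def by measurable
  have m: "m e = emeasure (lborel_fun k) S" if "orthonormal_frame k e" for e :: "nat \<Rightarrow> 'a"
  proof -
    have "m e = (\<integral>\<^sup>+c. indicator S c \<partial>lborel_fun k)"
      unfolding m_def g_def S_def norm_lin_comb_frame[OF that, symmetric]
      by (intro nn_integral_cong) (auto simp: indicator_def abs_square_le_1)
    then show ?thesis by simp
  qed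
  have "emeasure (lborel_fun k) S \<le> emeasure (lborel_fun k) (\<Pi>\<^sub>E i\<in>{..<k}. {-1..1::real})"
  proof (intro emeasure_mono)
    show "S \<subseteq> (\<Pi>\<^sub>E i\<in>{..<k}. {-1..1})"
    proof
      fix c assume c: "c \<in> S"
      have "c i ^ 2 \<le> 1" if "i < k" for i
        using c that sum_mono2[of "{..<k}" "{i}" "\<lambda>i. c i ^ 2"] by (auto simp: S_def)
      then show "c \<in> (\<Pi>\<^sub>E i\<in>{..<k}. {-1..1})"
        using c by (auto simp: S_def space_PiM PiE_iff abs_square_le_1 abs_le_iff)
    qed
  qed (auto intro!: sets_PiM_I_finite)
  also have "\<dots> < \<infinity>"
    by (subst emeasure_PiM) (auto simp: less_top power_less_top_ennreal)
  finally have fin: "emeasure (lborel_fun k) S < \<infinity>" .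
  \<comment> \<open>The cube with sides [0, 1/k] lies in \<open>S\<close>, because each of the k
    squares is at most 1/k. For k = 0 the side length 1/0 is 0, but its zeroth power is 1.\<close>
  have "(0::ennreal) < ennreal ((1 / real k) ^ k)"
    by (cases "k = 0") auto
  also have "\<dots> = (\<Prod>i<k. emeasure lborel {0..1 / real k})"
    by (simp add: ennreal_power)
  also have "\<dots> = emeasure (lborel_fun k) (\<Pi>\<^sub>E i\<in>{..<k}. {0..1 / real k})"
    by (subst emeasure_PiM) auto
  also have "\<dots> \<le> emeasure (lborel_fun k) S"
  proof (intro emeasure_mono subsetI S)
    fix c assume c: "c \<in> (\<Pi>\<^sub>E i\<in>{..<k}. {0..1 / real k})"
    have "(\<Sum>i<k. c i ^ 2) \<le> (\<Sum>i<k. 1 / real k)"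
    proof (intro sum_mono)
      fix i assume i: "i \<in> {..<k}"
      then have "0 \<le> c i" "c i \<le> 1 / real k"
        using c by (auto simp: PiE_iff)
      moreover have "1 / real k \<le> 1"
        using i by (auto simp: field_simps)
      ultimately have "c i * c i \<le> 1 / real k * 1"
        by (intro mult_mono) auto
      then show "c i ^ 2 \<le> 1 / real k"
        by (simp add: power2_eq_square)
    qed
    then show "c \<in> S"
      using c by (auto simp: S_def space_PiM PiE_iff split: if_splits)
  qed
  finally have pos: "emeasure (lborel_fun k) S > 0" .
  have "m e * (\<integral>\<^sup>+c. f (lin_comb k e' c) \<partial>lborel_fun k) =
        (\<integral>\<^sup>+c. f (lin_comb k e c) \<partial>lborel_fun k) * m e'"
    unfolding m_def
    by (intro nn_integral_lin_comb_unique[OF span]) (auto simp: g_def indicator_def)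
  then have "emeasure (lborel_fun k) S * (\<integral>\<^sup>+c. f (lin_comb k e' c) \<partial>lborel_fun k) =
        emeasure (lborel_fun k) S * (\<integral>\<^sup>+c. f (lin_comb k e c) \<partial>lborel_fun k)"
    using m assms(1,2) by (simp add: mult.commute)
  then show ?thesis
    using fin pos by (subst (asm) ennreal_mult_cancel_left) auto
qed

section \<open>Orthonormal frames and Gram-Schmidt residuals\<close>

lemma orthonormal_frame_mono: "orthonormal_frame l e \<Longrightarrow> k \<le> l \<Longrightarrow> orthonormal_frame k e"
  by (auto simp: orthonormal_frame_def)

lemma orthonormal_frame_independent:
  assumes "orthonormal_frame k e"
  shows "independent (e ` {..<k})" "card (e ` {..<k}) = k"
proof -
  have e: "e i \<bullet> e j = (if i = j then 1 else 0)" if "i < k" "j < k" for i j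
    using assms that by (auto simp: orthonormal_frame_def)
  have "inj_on e {..<k}"
    by (rule inj_onI) (metis e lessThan_iff zero_neq_one)
  then show "card (e ` {..<k}) = k"
    by (simp add: card_image)
  have "0 \<notin> e ` {..<k}"
    using e by (metis imageE inner_zero_left lessThan_iff zero_neq_one)
  moreover have "pairwise orthogonal (e ` {..<k})"
    using e by (auto simp: pairwise_def orthogonal_def)
  ultimately show "independent (e ` {..<k})"
    by (intro pairwise_orthogonal_independent)
qed

lemma dim_span_orthonormal_frame:
  "orthonormal_frame k e \<Longrightarrow> dim (span (e ` {..<k})) = k"
  using orthonormal_frame_independent by (metis dim_span_eq_card_independent)

text \<open>An orthonormal basis of \<open>W\<close> followed by one of its orthogonal complement.
  Allowing \<open>dim W < k\<close> covers spans of dependent points, where the first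
  \<open>k\<close> vectors span more than \<open>W\<close>.\<close>

lemma ex_orthonormal_frame_span:
  fixes W :: "'a::euclidean_space set"
  assumes W: "subspace W" "dim W \<le> k" "k \<le> DIM('a)"
  obtains e :: "nat \<Rightarrow> 'a" where "orthonormal_frame DIM('a) e" "W \<subseteq> span (e ` {..<k})"
proof -
  define W' where "W' = {y. \<forall>x\<in>W. orthogonal x y}"
  have W': "subspace W'"
    by (simp add: W'_def subspace_orthogonal_to_vectors)
  obtain B where B: "B \<subseteq> W" "pairwise orthogonal B" "\<And>x. x \<in> B \<Longrightarrow> norm x = 1"
    "card B = dim W" "span B = W" "independent B"
    using orthonormal_basis_subspace[OF W(1)] by metis
  obtain C where C: "C \<subseteq> W'" "pairwise orthogonal C" "\<And>x. x \<in> C \<Longrightarrow> norm x = 1"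
    "card C = dim W'" "independent C"
    using orthonormal_basis_subspace[OF W'] by metis
  have "dim W' + dim W = DIM('a)"
    using dim_subspace_orthogonal_to_vectors[OF W(1) subspace_UNIV] by (simp add: W'_def)
  obtain bs where bs: "set bs = B" "distinct bs"
    using finite_distinct_list B(6) independent_imp_finite by metis
  obtain cs where cs: "set cs = C" "distinct cs"
    using finite_distinct_list C(5) independent_imp_finite by metis
  have len: "length bs = dim W" "length (bs @ cs) = DIM('a)"
    using distinct_card[OF bs(2)] distinct_card[OF cs(2)] bs(1) cs(1) B(4) C(4) \<open>dim W' + dim W = DIM('a)\<close>
    by auto
  have orth: "x \<bullet> y = 0" if "x \<in> B" "y \<in> C" for x y
    using that B(1) C(1) by (auto simp: W'_def orthogonal_def)
  have orth': "y \<bullet> x = 0" if "x \<in> B" "y \<in> C" for x y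
    using orth[OF that] by (simp add: inner_commute)
  have "B \<inter> C = {}"
    using orth B(3) by (force simp: norm_eq_1)
  then have "distinct (bs @ cs)"
    using bs cs by simp
  have inner: "x \<bullet> y = (if x = y then 1 else 0)" if "x \<in> B \<union> C" "y \<in> B \<union> C" for x y
    using that B(2,3) C(2,3) orth by (auto simp: pairwise_def orthogonal_def norm_eq_1 orth')
  have mem: "(bs @ cs) ! i \<in> B \<union> C" if "i < DIM('a)" for i
    using nth_mem[of i "bs @ cs"] that len bs(1) cs(1) by auto
  have "orthonormal_frame DIM('a) (\<lambda>i. (bs @ cs) ! i)"
    unfolding orthonormal_frame_def
    using inner[OF mem mem] \<open>distinct (bs @ cs)\<close> len(2) by (simp add: nth_eq_iff_index_eq)
  moreover have "B \<subseteq> (\<lambda>i. (bs @ cs) ! i) ` {..<k}"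
  proof
    fix x assume "x \<in> B"
    then obtain i where "i < length bs" "x = bs ! i"
      using bs(1) by (metis in_set_conv_nth)
    then show "x \<in> (\<lambda>i. (bs @ cs) ! i) ` {..<k}"
      using len W by (intro image_eqI[of _ _ i]) (auto simp: nth_append)
  qed
  then have "W \<subseteq> span ((\<lambda>i. (bs @ cs) ! i) ` {..<k})"
    using B(5) span_mono by metis
  ultimately show thesis using that by blast
qed

section \<open>Gram-Schmidt vectors and residuals\<close>

text \<open>Since \<open>sgn\<close> sends 0 to 0, a point in the span of its predecessors
  contributes the zero vector. The construction is thus defined for all sequences, dependent ones
  included, and zero vectors drop out of the later sums.\<close>

fun gram_schmidt :: "(nat \<Rightarrow> 'a::real_inner) \<Rightarrow> nat \<Rightarrow> 'a" where
  "gram_schmidt x n = sgn (x n - (\<Sum>i<n. (x n \<bullet> gram_schmidt x i) *\<^sub>R gram_schmidt x i))"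

declare gram_schmidt.simps [simp del]

text \<open>The component of \<open>x n\<close> orthogonal to the span of the earlier points; its
  norm is the distance r of the overview.\<close>

definition residual :: "(nat \<Rightarrow> 'a::real_inner) \<Rightarrow> nat \<Rightarrow> 'a" where
  "residual x n = x n - (\<Sum>i<n. (x n \<bullet> gram_schmidt x i) *\<^sub>R gram_schmidt x i)"

lemma gram_schmidt_eq: "gram_schmidt x n = sgn (residual x n)"
  by (subst gram_schmidt.simps) (simp add: residual_def)

lemma gram_schmidt_cong:
  assumes "\<And>i. i \<le> n \<Longrightarrow> x i = y i"
  shows "gram_schmidt x n = gram_schmidt y n"
  using assms
proof (induction n rule: less_induct)
  case (less n)
  then have "gram_schmidt x i = gram_schmidt y i" if "i < n" for i
    using that by auto
  then show ?case
    using less.prems by (subst (1 2) gram_schmidt.simps) simp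
qed

text \<open>This makes iterated integration possible: when the point with index \<open>K\<close> is
  integrated out, the factors with smaller index are constants.\<close>

lemma residual_cong:
  assumes "\<And>i. i \<le> n \<Longrightarrow> x i = y i"
  shows "residual x n = residual y n"
proof -
  have "gram_schmidt x i = gram_schmidt y i" if "i < n" for i
    using that assms by (intro gram_schmidt_cong) auto
  then show ?thesis using assms by (simp add: residual_def)
qed

text \<open>If the residual vanishes, so does the last term, and \<open>x n\<close> is its own
  projection.\<close>

lemma gram_schmidt_expand:
  "x n = (\<Sum>i<n. (x n \<bullet> gram_schmidt x i) *\<^sub>R gram_schmidt x i) + norm (residual x n) *\<^sub>R gram_schmidt x n"
proof -
  have "norm (residual x n) *\<^sub>R gram_schmidt x n = residual x n"
    by (cases "residual x n = 0") (simp_all add: gram_schmidt_eq sgn_div_norm)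
  then show ?thesis by (simp add: residual_def)
qed

lemma gram_schmidt_self:
  "gram_schmidt x n \<bullet> gram_schmidt x n = (if residual x n = 0 then 0 else 1)"
  by (auto simp: gram_schmidt_eq norm_sgn dot_square_norm)

lemma gram_schmidt_orthogonal:
  "i < j \<Longrightarrow> gram_schmidt x j \<bullet> gram_schmidt x i = 0"
proof (induction j arbitrary: i rule: less_induct)
  case (less j)
  have orth: "gram_schmidt x l \<bullet> gram_schmidt x i = (if l = i then gram_schmidt x i \<bullet> gram_schmidt x i else 0)"
    if "l < j" for l
    using less.IH[of l i] less.IH[of i l] that less.prems
    by (cases l i rule: linorder_cases) (auto simp: inner_commute)
  have "residual x j \<bullet> gram_schmidt x i =
      x j \<bullet> gram_schmidt x i - (\<Sum>l<j. (x j \<bullet> gram_schmidt x l) * (gram_schmidt x l \<bullet> gram_schmidt x i))"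
    by (simp add: residual_def inner_diff_left inner_sum_left)
  also have "(\<Sum>l<j. (x j \<bullet> gram_schmidt x l) * (gram_schmidt x l \<bullet> gram_schmidt x i)) =
      (\<Sum>l<j. if l = i then (x j \<bullet> gram_schmidt x i) * (gram_schmidt x i \<bullet> gram_schmidt x i) else 0)"
    by (intro sum.cong refl, subst orth) auto
  \<comment> \<open>Either \<open>gram_schmidt x i\<close> is a unit vector and the two terms
    cancel, or it is 0 and both terms vanish.\<close>
  also have "x j \<bullet> gram_schmidt x i - \<dots> = 0"
    using less.prems gram_schmidt_self[of x i] by (auto simp: gram_schmidt_eq[of x i])
  finally show ?case
    by (simp add: gram_schmidt_eq[of x j] sgn_div_norm)
qed

lemma gram_schmidt_frame:
  assumes "\<And>i. i < k \<Longrightarrow> residual x i \<noteq> 0"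
  shows "orthonormal_frame k (gram_schmidt x)"
  unfolding orthonormal_frame_def
proof (intro allI impI)
  fix i j assume "i < k" "j < k"
  then show "gram_schmidt x i \<bullet> gram_schmidt x j = (if i = j then 1 else 0)"
    using assms gram_schmidt_self[of x i] gram_schmidt_orthogonal[of i j x] gram_schmidt_orthogonal[of j i x]
    by (cases i j rule: linorder_cases) (auto simp: inner_commute)
qed

lemma span_gram_schmidt:
  fixes x :: "nat \<Rightarrow> 'a::euclidean_space"
  shows "span (gram_schmidt x ` {..<n}) = span (x ` {..<n})"
proof (induction n)
  case (Suc n)
  have le: "span (u ` {..<n}) \<subseteq> span (u ` {..<Suc n})" for u :: "nat \<Rightarrow> 'a"
    by (intro span_mono) auto
  have p: "(\<Sum>i<n. (x n \<bullet> gram_schmidt x i) *\<^sub>R gram_schmidt x i) \<in> span (gram_schmidt x ` {..<n})"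
    by (rule lin_comb_in_span)
  have last: "u n \<in> span (u ` {..<Suc n})" for u :: "nat \<Rightarrow> 'a"
    by (intro span_base) auto
  have "x n \<in> span (gram_schmidt x ` {..<Suc n})"
    using p le[of "gram_schmidt x"] last[of "gram_schmidt x"]
    by (subst gram_schmidt_expand) (intro span_add span_scale, auto)
  moreover have "residual x n \<in> span (x ` {..<Suc n})"
    unfolding residual_def using p le[of x] last[of x] Suc.IH by (intro span_diff) auto
  then have "gram_schmidt x n \<in> span (x ` {..<Suc n})"
    by (simp add: gram_schmidt_eq[of x n] sgn_div_norm span_scale)
  moreover have "gram_schmidt x ` {..<n} \<subseteq> span (x ` {..<Suc n})"
    using Suc.IH le[of x] span_superset[of "gram_schmidt x ` {..<n}"] by blast
  moreover have "x ` {..<n} \<subseteq> span (gram_schmidt x ` {..<Suc n})"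
    using Suc.IH le[of "gram_schmidt x"] span_superset[of "x ` {..<n}"] by blast
  ultimately show ?case
    unfolding span_eq by (auto simp: lessThan_Suc)
qed auto

text \<open>Relative to the Gram-Schmidt vectors the points form a triangular array with the
  residual norms on the diagonal.\<close>

lemma inner_gram_schmidt:
  fixes x :: "nat \<Rightarrow> 'a::euclidean_space"
  shows "x j \<bullet> gram_schmidt x j = norm (residual x j)"
    and "i < j \<Longrightarrow> x i \<bullet> gram_schmidt x j = 0"
proof -
  have orth: "gram_schmidt x l \<bullet> gram_schmidt x j = 0" if "l < j" for l
    using gram_schmidt_orthogonal[OF that, of x] by (simp add: inner_commute)
  have "x j \<bullet> gram_schmidt x j = ((\<Sum>i<j. (x j \<bullet> gram_schmidt x i) *\<^sub>R gram_schmidt x i) +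
      norm (residual x j) *\<^sub>R gram_schmidt x j) \<bullet> gram_schmidt x j"
    by (rule arg_cong[OF gram_schmidt_expand])
  also have "\<dots> = norm (residual x j)"
    by (simp add: inner_add_left inner_sum_left orth gram_schmidt_self)
  finally show "x j \<bullet> gram_schmidt x j = norm (residual x j)" .
  assume "i < j"
  have "x i \<bullet> gram_schmidt x j = ((\<Sum>l<i. (x i \<bullet> gram_schmidt x l) *\<^sub>R gram_schmidt x l) +
      norm (residual x i) *\<^sub>R gram_schmidt x i) \<bullet> gram_schmidt x j"
    by (rule arg_cong[OF gram_schmidt_expand])
  also have "\<dots> = 0"
    using \<open>i < j\<close> by (simp add: inner_add_left inner_sum_left orth)
  finally show "x i \<bullet> gram_schmidt x j = 0" .
qed

text \<open>Pairing with the last Gram-Schmidt vector kills all lower terms and reads off the top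
  coefficient; the remaining ones follow by induction.\<close>

lemma lin_comb_inj:
  fixes x :: "nat \<Rightarrow> 'a::euclidean_space"
  assumes "\<And>i. i < k \<Longrightarrow> residual x i \<noteq> 0" "lin_comb k x b = lin_comb k x c" "i < k"
  shows "b i = c i"
  using assms
proof (induction k)
  case (Suc k)
  have inner: "lin_comb (Suc k) x b \<bullet> gram_schmidt x k = b k * norm (residual x k)" for b
    by (simp add: inner_add_left inner_sum_left inner_gram_schmidt)
  have "b k = c k"
    using inner[of b] inner[of c] Suc.prems(1)[of k] unfolding Suc.prems(2) by simp
  then show ?case
    using Suc by (cases "i = k") auto
qed simp

text \<open>The linear change of variables for a triangular matrix, without determinants. In
  \<open>x k = p + r q\<close>, with \<open>q\<close> the new Gram-Schmidt vector and
  \<open>p\<close> in the span of the earlier ones, the factor \<open>r\<close> rescales the last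
  coordinate. The shear by \<open>t *\<^sub>R p\<close> is absorbed by translation invariance in the
  other coordinates before the induction hypothesis replaces them.\<close>

lemma nn_integral_lin_comb_gram_schmidt:
  fixes x :: "nat \<Rightarrow> 'a::euclidean_space"
  assumes "\<And>i. i < k \<Longrightarrow> residual x i \<noteq> 0" and "f \<in> borel_measurable borel"
  shows "(\<integral>\<^sup>+c. f (lin_comb k (gram_schmidt x) c) \<partial>lborel_fun k) =
         ennreal (\<Prod>i<k. norm (residual x i)) * (\<integral>\<^sup>+c. f (lin_comb k x c) \<partial>lborel_fun k)"
  using assms
proof (induction k arbitrary: f)
  case 0
  then show ?case by simp
next
  case (Suc k)
  note [measurable] = Suc.prems(2)
  interpret product_sigma_finite "\<lambda>_. lborel :: real measure" by standard
  interpret sigma_finite_measure "lborel_fun k :: (nat \<Rightarrow> real) measure" by (rule sigma_finite_lborel_fun)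
  let ?q = "gram_schmidt x" and ?r = "norm (residual x k)"
  define p where "p = (\<Sum>i<k. (x k \<bullet> ?q i) *\<^sub>R ?q i)"
  have p: "t *\<^sub>R p \<in> span (?q ` {..<k})" for t
    unfolding p_def by (intro span_scale lin_comb_in_span)
  have xk: "x k = p + ?r *\<^sub>R ?q k"
    unfolding p_def by (rule gram_schmidt_expand)
  have split: "(\<integral>\<^sup>+c. f (lin_comb (Suc k) u c) \<partial>lborel_fun (Suc k)) =
      (\<integral>\<^sup>+t. (\<integral>\<^sup>+c. f (lin_comb k u c + t *\<^sub>R u k) \<partial>lborel_fun k) \<partial>lborel)" for u :: "nat \<Rightarrow> 'a"
  proof -
    have "lin_comb k u (c(k := t)) = lin_comb k u c" for c t
      by (intro sum.cong) auto
    then show ?thesis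
      unfolding lessThan_Suc by (subst product_nn_integral_insert_rev) (auto simp: add.commute)
  qed
  have "(\<integral>\<^sup>+t. (\<integral>\<^sup>+c. f (lin_comb k ?q c + t *\<^sub>R ?q k) \<partial>lborel_fun k) \<partial>lborel) =
      ennreal \<bar>?r\<bar> * (\<integral>\<^sup>+t. (\<integral>\<^sup>+c. f (lin_comb k ?q c + (0 + ?r * t) *\<^sub>R ?q k) \<partial>lborel_fun k) \<partial>lborel)"
    by (rule nn_integral_real_affine) (use Suc.prems(1)[of k] in auto)
  also have "(\<integral>\<^sup>+t. (\<integral>\<^sup>+c. f (lin_comb k ?q c + (0 + ?r * t) *\<^sub>R ?q k) \<partial>lborel_fun k) \<partial>lborel) =
      (\<integral>\<^sup>+t. (\<integral>\<^sup>+c. f (lin_comb k ?q c + t *\<^sub>R x k) \<partial>lborel_fun k) \<partial>lborel)"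
  proof (rule nn_integral_cong)
    fix t
    show "(\<integral>\<^sup>+c. f (lin_comb k ?q c + (0 + ?r * t) *\<^sub>R ?q k) \<partial>lborel_fun k) =
        (\<integral>\<^sup>+c. f (lin_comb k ?q c + t *\<^sub>R x k) \<partial>lborel_fun k)"
      using nn_integral_lin_comb_translate[OF p[of t], of "\<lambda>y. f (y + (?r * t) *\<^sub>R ?q k)"]
      by (simp add: xk algebra_simps)
  qed
  also have "\<dots> = (\<integral>\<^sup>+t. ennreal (\<Prod>i<k. norm (residual x i)) *
      (\<integral>\<^sup>+c. f (lin_comb k x c + t *\<^sub>R x k) \<partial>lborel_fun k) \<partial>lborel)"
    by (intro nn_integral_cong Suc.IH[of "\<lambda>y. f (y + t *\<^sub>R x k)" for t]) (use Suc.prems in auto)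
  also have "\<dots> = ennreal (\<Prod>i<k. norm (residual x i)) *
      (\<integral>\<^sup>+t. (\<integral>\<^sup>+c. f (lin_comb k x c + t *\<^sub>R x k) \<partial>lborel_fun k) \<partial>lborel)"
    by (rule nn_integral_cmult) measurable
  finally show ?case
    unfolding split[of x] split[of ?q] by (simp add: ennreal_mult prod_nonneg mult_ac)
qed

section \<open>Volume of a simplex\<close>

lemma convex_hull_insert_0_lin_comb:
  fixes x :: "nat \<Rightarrow> 'a::euclidean_space"
  shows "convex hull (insert 0 (x ` {..<k})) =
         {lin_comb k x b |b. (\<forall>i<k. 0 \<le> b i) \<and> sum b {..<k} \<le> 1}" (is "_ = ?T")
proof (intro equalityI)
  show "convex hull (insert 0 (x ` {..<k})) \<subseteq> ?T"
  proof (rule hull_minimal)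
    show "convex ?T"
    proof (rule convexI)
      fix y z u v
      assume "y \<in> ?T" "z \<in> ?T" and uv: "0 \<le> (u::real)" "0 \<le> v" "u + v = 1"
      then obtain b c where b: "y = lin_comb k x b" "\<forall>i<k. 0 \<le> b i" "sum b {..<k} \<le> 1"
        and c: "z = lin_comb k x c" "\<forall>i<k. 0 \<le> c i" "sum c {..<k} \<le> 1"
        by blast
      have "u *\<^sub>R y + v *\<^sub>R z = lin_comb k x (\<lambda>i. u * b i + v * c i)"
        by (simp add: b c scaleR_sum_right scaleR_add_left sum.distrib)
      moreover have "(\<Sum>i<k. u * b i + v * c i) = u * sum b {..<k} + v * sum c {..<k}"
        by (simp add: sum.distrib sum_distrib_left)
      moreover have "u * sum b {..<k} + v * sum c {..<k} \<le> 1"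
        using b(3) c(3) uv by (intro convex_bound_le) auto
      ultimately show "u *\<^sub>R y + v *\<^sub>R z \<in> ?T"
        using b c uv by (intro CollectI exI[of _ "\<lambda>i. u * b i + v * c i"]) auto
    qed
    have "0 \<in> ?T"
      by (intro CollectI exI[of _ "\<lambda>_. 0"]) auto
    moreover have "x i \<in> ?T" if "i < k" for i
      using that by (intro CollectI exI[of _ "\<lambda>j. if j = i then 1 else 0"]) (auto simp: if_distrib[of "\<lambda>a. a *\<^sub>R _"] cong: if_cong)
    ultimately show "insert 0 (x ` {..<k}) \<subseteq> ?T"
      by auto
  qed
  show "?T \<subseteq> convex hull (insert 0 (x ` {..<k}))"
  proof
    fix y assume "y \<in> ?T"
    then obtain b where b: "y = lin_comb k x b" "\<forall>i<k. 0 \<le> b i" "sum b {..<k} \<le> 1"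
      by blast
    \<comment> \<open>The weight missing to 1 goes to an additional point with index
      \<open>k\<close>, placed at the origin.\<close>
    define a where "a = b(k := 1 - sum b {..<k})"
    define z where "z = x(k := 0)"
    have "(\<Sum>i<Suc k. a i *\<^sub>R z i) \<in> convex hull (insert 0 (x ` {..<k}))"
    proof (rule convex_sum)
      show "sum a {..<Suc k} = 1"
        by (simp add: a_def)
      show "z i \<in> convex hull (insert 0 (x ` {..<k}))" if "i \<in> {..<Suc k}" for i
        using that by (intro hull_inc) (auto simp: z_def)
    qed (use b in \<open>auto simp: a_def\<close>)
    also have "(\<Sum>i<Suc k. a i *\<^sub>R z i) = y"
      by (simp add: a_def z_def b(1))
    finally show "y \<in> convex hull (insert 0 (x ` {..<k}))" .
  qed
qed

lemma sets_convex_hull_finite: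
  fixes S :: "'a::euclidean_space set"
  shows "finite S \<Longrightarrow> convex hull S \<in> sets borel"
  by (intro borel_closed compact_imp_closed finite_imp_compact_convex_hull)

text \<open>In the coefficients with respect to \<open>x\<close> itself the hull is the standard
  simplex, of volume 1/k!. Injectivity of \<open>lin_comb k x\<close> ensures that no other
  coefficients land in the hull. The change to orthonormal coordinates supplies the product.\<close>

lemma nn_integral_simplex_gram_schmidt:
  fixes x :: "nat \<Rightarrow> 'a::euclidean_space"
  assumes res: "\<And>i. i < k \<Longrightarrow> residual x i \<noteq> 0"
  shows "(\<integral>\<^sup>+c. indicator (convex hull (insert 0 (x ` {..<k}))) (lin_comb k (gram_schmidt x) c) \<partial>lborel_fun k) =
         ennreal ((\<Prod>i<k. norm (residual x i)) / fact k)"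
proof -
  define S where "S = convex hull (insert 0 (x ` {..<k}))"
  define T where "T = {b. (\<forall>i\<in>{..<k}. 0 \<le> b i) \<and> sum b {..<k} \<le> (1::real)} \<inter> space (lborel_fun k)"
  have S: "S \<in> sets borel"
    unfolding S_def by (intro sets_convex_hull_finite) auto
  have "indicator S (lin_comb k x c) = (indicator T c :: ennreal)" if "c \<in> space (lborel_fun k)" for c
  proof -
    have "c \<in> T" if cS: "lin_comb k x c \<in> S"
    proof -
      obtain b where b: "lin_comb k x c = lin_comb k x b" "\<forall>i<k. 0 \<le> b i" "sum b {..<k} \<le> 1"
        using cS unfolding S_def convex_hull_insert_0_lin_comb by blast
      have bc: "c i = b i" if "i < k" for i
        by (rule lin_comb_inj[OF res b(1) that])
      then have "sum c {..<k} = sum b {..<k}"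
        by (intro sum.cong) auto
      then show ?thesis
        using b bc \<open>c \<in> space (lborel_fun k)\<close> by (simp add: T_def)
    qed
    moreover have "lin_comb k x c \<in> S" if "c \<in> T"
      unfolding S_def convex_hull_insert_0_lin_comb
      using that by (intro CollectI exI[of _ c]) (simp add: T_def)
    ultimately have "lin_comb k x c \<in> S \<longleftrightarrow> c \<in> T" by blast
    then show ?thesis by (simp add: indicator_def)
  qed
  then have "(\<integral>\<^sup>+c. indicator S (lin_comb k x c) \<partial>lborel_fun k) = (\<integral>\<^sup>+c. indicator T c \<partial>lborel_fun k)"
    by (intro nn_integral_cong)
  also have "\<dots> = emeasure (lborel_fun k) T"
  proof (rule nn_integral_indicator)
    have "T = {b \<in> space (lborel_fun k). (\<forall>i\<in>{..<k}. 0 \<le> b i) \<and> sum b {..<k} \<le> (1::real)}"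
      by (auto simp: T_def)
    also have "\<dots> \<in> sets (lborel_fun k)"
      by measurable
    finally show "T \<in> sets (lborel_fun k)" .
  qed
  also have "\<dots> = ennreal (1 / fact k)"
    unfolding T_def by (subst emeasure_std_simplex_aux) auto
  finally have "(\<integral>\<^sup>+c. indicator S (lin_comb k x c) \<partial>lborel_fun k) = ennreal (1 / fact k)" .
  then show ?thesis
    using nn_integral_lin_comb_gram_schmidt[of k x "indicator S"] res S
    by (simp add: S_def[symmetric] ennreal_mult[symmetric] prod_nonneg)
qed

section \<open>Independence of the volume from origin and frame\<close>

lemma frame_preimage_measure:
  fixes e :: "nat \<Rightarrow> 'a::euclidean_space"
  assumes S: "S \<in> sets borel"
  shows "{c \<in> {..<k} \<rightarrow>\<^sub>E UNIV. frame_point k p e c \<in> S} \<in> sets (lborel_fun k)"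
    and "emeasure (lborel_fun k) {c \<in> {..<k} \<rightarrow>\<^sub>E UNIV. frame_point k p e c \<in> S} =
         (\<integral>\<^sup>+c. indicator S (p + lin_comb k e c) \<partial>lborel_fun k)"
proof -
  note S[measurable]
  have eq: "{c \<in> {..<k} \<rightarrow>\<^sub>E UNIV. frame_point k p e c \<in> S} =
      {c \<in> space (lborel_fun k). p + lin_comb k e c \<in> S}" (is "?A = ?B")
    by (auto simp: space_PiM frame_point_def)
  have "?B \<in> sets (lborel_fun k)"
    by measurable
  then show A: "?A \<in> sets (lborel_fun k)"
    unfolding eq .
  have "emeasure (lborel_fun k) ?A = (\<integral>\<^sup>+c. indicator ?A c \<partial>lborel_fun k)"
    using A by simp
  also have "\<dots> = (\<integral>\<^sup>+c. indicator S (p + lin_comb k e c) \<partial>lborel_fun k)"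
    by (intro nn_integral_cong) (auto simp: indicator_def space_PiM frame_point_def)
  finally show "emeasure (lborel_fun k) ?A = (\<integral>\<^sup>+c. indicator S (p + lin_comb k e c) \<partial>lborel_fun k)" .
qed

text \<open>For dimension reasons some \<open>e i\<close> lies outside \<open>W\<close>. Each line
  in direction \<open>e i\<close> then meets \<open>W\<close> in at most one point, so integrating
  the i-th coordinate first gives 0.\<close>

lemma nn_integral_frame_low_dim:
  fixes e :: "nat \<Rightarrow> 'a::euclidean_space"
  assumes "orthonormal_frame k e" "subspace W" "dim W < k"
  shows "(\<integral>\<^sup>+c. indicator W (p + lin_comb k e c) \<partial>lborel_fun k) = 0"
proof -
  interpret product_sigma_finite "\<lambda>_. lborel :: real measure" by standard
  have W[measurable]: "W \<in> sets borel"
    using closed_subspace[OF assms(2)] by (rule borel_closed)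
  obtain i where i: "i < k" "e i \<notin> W"
  proof (rule ccontr)
    assume "\<not> thesis"
    then have "e ` {..<k} \<subseteq> W" using that by auto
    then have "card (e ` {..<k}) \<le> dim W"
      using orthonormal_frame_independent(1)[OF assms(1)] by (rule independent_card_le_dim)
    then show False
      using assms(3) orthonormal_frame_independent(2)[OF assms(1)] by simp
  qed
  define J where "J = {..<k} - {i}"
  have J: "{..<k} = insert i J" "finite J" "i \<notin> J"
    using i by (auto simp: J_def)
  have "(\<integral>\<^sup>+c. indicator W (p + lin_comb k e c) \<partial>lborel_fun k) =
      (\<integral>\<^sup>+c. (\<integral>\<^sup>+t. indicator W (p + (\<Sum>j\<in>insert i J. (c(i := t)) j *\<^sub>R e j)) \<partial>lborel) \<partial>(\<Pi>\<^sub>M j\<in>J. lborel))"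
    unfolding J(1) using J by (subst product_nn_integral_insert) auto
  also have "\<dots> = (\<integral>\<^sup>+c. 0 \<partial>(\<Pi>\<^sub>M j\<in>J. (lborel :: real measure)))"
  proof (rule nn_integral_cong)
    fix c :: "nat \<Rightarrow> real"
    let ?z = "p + (\<Sum>j\<in>J. c j *\<^sub>R e j)"
    have eq: "p + (\<Sum>j\<in>insert i J. (c(i := t)) j *\<^sub>R e j) = ?z + t *\<^sub>R e i" for t
    proof -
      have "(\<Sum>j\<in>J. (c(i := t)) j *\<^sub>R e j) = (\<Sum>j\<in>J. c j *\<^sub>R e j)"
        using J by (intro sum.cong) auto
      then show ?thesis using J by (simp add: algebra_simps)
    qed
    have uniq: "s = t" if "?z + s *\<^sub>R e i \<in> W" "?z + t *\<^sub>R e i \<in> W" for s t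
    proof (rule ccontr)
      assume "s \<noteq> t"
      have "(?z + s *\<^sub>R e i) - (?z + t *\<^sub>R e i) \<in> W"
        using that assms(2) by (intro subspace_diff)
      then have "(s - t) *\<^sub>R e i \<in> W"
        by (simp add: algebra_simps)
      then have "inverse (s - t) *\<^sub>R ((s - t) *\<^sub>R e i) \<in> W"
        by (rule subspace_scale[OF assms(2)])
      then show False using \<open>s \<noteq> t\<close> i by simp
    qed
    have "AE t in lborel. \<not> (?z + t *\<^sub>R e i \<in> W)"
    proof (cases "\<exists>s. ?z + s *\<^sub>R e i \<in> W")
      case True
      then obtain s where "?z + s *\<^sub>R e i \<in> W" ..
      then show ?thesis
        using AE_lborel_singleton[of s] uniq by (auto elim!: AE_mp)
    qed auto
    then show "(\<integral>\<^sup>+t. indicator W (p + (\<Sum>j\<in>insert i J. (c(i := t)) j *\<^sub>R e j)) \<partial>lborel) = 0"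
      unfolding eq by (subst nn_integral_0_iff_AE) (auto simp: indicator_def elim!: AE_mp)
  qed
  finally show ?thesis by simp
qed

text \<open>The choice is determined as soon as one eligible frame exists and all of them give the
  same value.\<close>

lemma flat_volume_eqI:
  assumes "orthonormal_frame k e" "S \<subseteq> range (frame_point k p e)"
    and "\<And>p e. orthonormal_frame k e \<Longrightarrow> S \<subseteq> range (frame_point k p e) \<Longrightarrow>
      measure (\<Pi>\<^sub>M i\<in>{..<k}. lborel) {c \<in> {..<k} \<rightarrow>\<^sub>E UNIV. frame_point k p e c \<in> S} = v"
  shows "flat_volume k S = v"
    unfolding flat_volume_def
proof (rule some_equality)
  show "\<exists>p e. orthonormal_frame k e \<and> S \<subseteq> range (frame_point k p e) \<and>
      v = measure (\<Pi>\<^sub>M i\<in>{..<k}. lborel) {c \<in> {..<k} \<rightarrow>\<^sub>E UNIV. frame_point k p e c \<in> S}"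
    using assms(1,2) assms(3)[OF assms(1,2)] by (intro exI[of _ p] exI[of _ e]) simp
qed (use assms(3) in blast)

lemma dim_span_degenerate:
  fixes x :: "nat \<Rightarrow> 'a::euclidean_space"
  assumes "j < k" "residual x j = 0"
  shows "dim (span (x ` {..<k})) < k"
proof -
  have "gram_schmidt x j = 0"
    using assms(2) by (simp add: gram_schmidt_eq[of x j])
  then have "gram_schmidt x ` {..<k} \<subseteq> insert 0 (gram_schmidt x ` ({..<k} - {j}))"
    by auto
  then have "span (gram_schmidt x ` {..<k}) \<subseteq> span (gram_schmidt x ` ({..<k} - {j}))"
    by (metis span_insert_0 span_mono)
  then have "dim (span (x ` {..<k})) \<le> dim (span (gram_schmidt x ` ({..<k} - {j})))"
    unfolding span_gram_schmidt by (rule dim_subset)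
  also have "\<dots> \<le> card (gram_schmidt x ` ({..<k} - {j}))"
    unfolding dim_span by (intro dim_le_card') auto
  also have "\<dots> \<le> card ({..<k} - {j})"
    by (intro card_image_le) auto
  also have "\<dots> < k"
    using assms by simp
  finally show ?thesis .
qed

text \<open>In the nondegenerate case the points span k dimensions, so every eligible frame spans
  the same space as the Gram-Schmidt vectors and frame independence applies. In the degenerate case
  the frame is not determined by the points, but the hull lies in a subspace of dimension below k,
  which is null in every k-dimensional frame; the product also has a zero factor.\<close>

theorem flat_volume_simplex:
  fixes x :: "nat \<Rightarrow> 'a::euclidean_space"
  assumes "k \<le> DIM('a)"
  shows "flat_volume k (convex hull (insert 0 (x ` {..<k}))) = (\<Prod>i<k. norm (residual x i)) / fact k"
proof -
  define S where "S = convex hull (insert 0 (x ` {..<k}))"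
  define W where "W = span (x ` {..<k})"
  have W: "subspace W" by (simp add: W_def)
  have S: "S \<in> sets borel" "0 \<in> S" "S \<subseteq> W" "x ` {..<k} \<subseteq> S"
  proof -
    show "S \<subseteq> W"
      unfolding S_def W_def
      by (intro hull_minimal) (auto intro: span_base span_zero subspace_imp_convex)
  qed (auto simp: S_def intro!: sets_convex_hull_finite hull_inc)
  have range: "range (frame_point k p e) = (+) p ` span (e ` {..<k})" for p and e :: "nat \<Rightarrow> 'a"
    by (auto simp: frame_point_def span_eq_lin_comb image_iff)
  have "dim W \<le> card (x ` {..<k})"
    unfolding W_def dim_span by (intro dim_le_card') auto
  also have "\<dots> \<le> k"
    using card_image_le[of "{..<k}" x] by simp
  finally have "dim W \<le> k" .
  then obtain e0 :: "nat \<Rightarrow> 'a" where "orthonormal_frame DIM('a) e0" "W \<subseteq> span (e0 ` {..<k})"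
    using ex_orthonormal_frame_span[OF W] assms by metis
  then have e0: "orthonormal_frame k e0" "S \<subseteq> range (frame_point k 0 e0)"
    using assms S by (auto simp: range intro: orthonormal_frame_mono)
  have "flat_volume k S = (\<Prod>i<k. norm (residual x i)) / fact k"
  proof (rule flat_volume_eqI[OF e0])
    fix p and e :: "nat \<Rightarrow> 'a"
    assume e: "orthonormal_frame k e" and sub: "S \<subseteq> range (frame_point k p e)"
    let ?A = "{c \<in> {..<k} \<rightarrow>\<^sub>E UNIV. frame_point k p e c \<in> S}"
    have "emeasure (lborel_fun k) ?A = ennreal ((\<Prod>i<k. norm (residual x i)) / fact k)"
    proof (cases "\<forall>i<k. residual x i \<noteq> 0")
      case True
      obtain a where a: "p + a = 0" "a \<in> span (e ` {..<k})"
        using sub S(2) unfolding range by force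
      have p: "p \<in> span (e ` {..<k})"
        using a span_neg[OF a(2)] by (simp add: eq_neg_iff_add_eq_0[symmetric])
      have "x ` {..<k} \<subseteq> span (e ` {..<k})"
        using sub S(4) p unfolding range by (auto dest!: subsetD simp: span_add)
      then have "W \<subseteq> span (e ` {..<k})"
        unfolding W_def by (rule span_minimal) simp
      moreover have "dim (span (gram_schmidt x ` {..<k})) = k"
        using True by (intro dim_span_orthonormal_frame gram_schmidt_frame) blast
      then have "dim W = k"
        unfolding W_def span_gram_schmidt .
      ultimately have "W = span (e ` {..<k})"
        using dim_span_orthonormal_frame[OF e] W by (intro subspace_dim_equal) auto
      then have span: "span (e ` {..<k}) = span (gram_schmidt x ` {..<k})"
        by (simp add: W_def span_gram_schmidt)
      have "emeasure (lborel_fun k) ?A = (\<integral>\<^sup>+c. indicator S (p + lin_comb k e c) \<partial>lborel_fun k)"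
        by (rule frame_preimage_measure[OF S(1)])
      also have "\<dots> = (\<integral>\<^sup>+c. indicator S (lin_comb k e c) \<partial>lborel_fun k)"
        using S(1) by (intro nn_integral_lin_comb_translate p) auto
      also have "\<dots> = (\<integral>\<^sup>+c. indicator S (lin_comb k (gram_schmidt x) c) \<partial>lborel_fun k)"
        using S(1) True by (intro nn_integral_frame_unique e span gram_schmidt_frame) auto
      also have "\<dots> = ennreal ((\<Prod>i<k. norm (residual x i)) / fact k)"
        unfolding S_def using True by (intro nn_integral_simplex_gram_schmidt) auto
      finally show ?thesis .
    next
      case False
      then obtain j where j: "j < k" "residual x j = 0" by blast
      have "emeasure (lborel_fun k) ?A = (\<integral>\<^sup>+c. indicator S (p + lin_comb k e c) \<partial>lborel_fun k)"
        by (rule frame_preimage_measure[OF S(1)])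
      also have "\<dots> \<le> (\<integral>\<^sup>+c. indicator W (p + lin_comb k e c) \<partial>lborel_fun k)"
        using S(3) by (intro nn_integral_mono) (auto simp: indicator_def)
      also have "\<dots> = 0"
        using dim_span_degenerate[OF j] by (intro nn_integral_frame_low_dim[OF e W]) (simp add: W_def)
      finally have "emeasure (lborel_fun k) ?A = 0" by simp
      moreover have "(\<Prod>i<k. norm (residual x i)) = 0"
        using j by (intro prod_zero) auto
      ultimately show ?thesis by (metis div_0 ennreal_0)
    qed
    then show "measure (lborel_fun k) ?A = (\<Prod>i<k. norm (residual x i)) / fact k"
      by (simp add: measure_def prod_nonneg)
  qed
  then show ?thesis by (simp add: S_def)
qed

section \<open>Integrability of negative powers of residuals\<close>

text \<open>Rotation invariance of Lebesgue measure: an enumeration of \<open>Basis\<close> and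
  \<open>e\<close> are two orthonormal frames of the whole space, and the integral does not
  distinguish them.\<close>

lemma nn_integral_lborel_frame:
  fixes e :: "nat \<Rightarrow> 'a::euclidean_space"
  assumes e: "orthonormal_frame DIM('a) e" and f[measurable]: "f \<in> borel_measurable borel"
  shows "(\<integral>\<^sup>+x. f x \<partial>lborel) = (\<integral>\<^sup>+c. f (lin_comb DIM('a) e c) \<partial>lborel_fun DIM('a))"
proof -
  let ?d = "DIM('a)"
  obtain b where b: "bij_betw b {..<?d} (Basis :: 'a set)"
    using ex_bij_betw_nat_finite[OF finite_Basis] by (auto simp: atLeast0LessThan)
  have b_mem: "b i \<in> Basis" if "i < ?d" for i
    using b that by (auto simp: bij_betw_def)
  have frame_b: "orthonormal_frame ?d b"
    unfolding orthonormal_frame_def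
    using b b_mem by (auto simp: inner_Basis bij_betw_def inj_on_def)
  have "b ` {..<?d} = Basis"
    using b by (simp add: bij_betw_def)
  moreover have "span (e ` {..<?d}) = UNIV"
    using dim_span_orthonormal_frame[OF e] dim_eq_full by (metis dim_span span_span)
  ultimately have span: "span (b ` {..<?d}) = span (e ` {..<?d})"
    by simp
  have "(\<integral>\<^sup>+x. f x \<partial>lborel) = (\<integral>\<^sup>+x. f (\<Sum>v\<in>Basis. x v *\<^sub>R v) \<partial>(\<Pi>\<^sub>M v\<in>Basis. lborel))"
    by (subst lborel_eq, subst nn_integral_distr) auto
  also have "\<dots> = (\<integral>\<^sup>+x. f (lin_comb ?d b (\<lambda>i\<in>{..<?d}. x (b i))) \<partial>(\<Pi>\<^sub>M v\<in>Basis. lborel))"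
    by (simp add: sum.reindex_bij_betw[OF b, symmetric])
  also have "\<dots> = (\<integral>\<^sup>+c. f (lin_comb ?d b c) \<partial>lborel_fun ?d)"
    by (rule nn_integral_PiM_lborel_reindex[OF b]) auto
  also have "\<dots> = (\<integral>\<^sup>+c. f (lin_comb ?d e c) \<partial>lborel_fun ?d)"
    using frame_b e span f by (rule nn_integral_frame_unique)
  finally show ?thesis .
qed

text \<open>
  The power \<open>r\<^sup>\<beta>\<close> for \<open>\<beta> < 0\<close> with the value \<open>\<infinity>\<close> at \<open>r = 0\<close> (where \<^term>\<open>0 powr \<beta>\<close> is 0), so that
  finite integrals also show that \<open>r \<noteq> 0\<close> almost everywhere.
\<close>

definition neg_powr :: "real \<Rightarrow> real \<Rightarrow> ennreal" where
  "neg_powr \<beta> r = (if r = 0 then \<infinity> else ennreal (r powr \<beta>))"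

lemma measurable_neg_powr[measurable]: "neg_powr \<beta> \<in> borel_measurable borel"
  unfolding neg_powr_def by measurable

lemma nn_integral_neg_powr_finite:
  assumes "- 1 < \<beta>"
  shows "(\<integral>\<^sup>+t. neg_powr \<beta> \<bar>t\<bar> * indicator {-1..1} t \<partial>lborel) < \<infinity>"
proof -
  have half: "(\<integral>\<^sup>+t. neg_powr \<beta> \<bar>t\<bar> * indicator {0..1} t \<partial>lborel) < \<infinity>"
  proof -
    obtain I where "((\<lambda>t. t powr \<beta>) has_integral I) {0..1::real}"
      using integrable_on_powr_from_0[OF assms, of 1] by (auto simp: integrable_on_def)
    then have "(\<integral>\<^sup>+t. ennreal (t powr \<beta>) * indicator {0..1} t \<partial>lborel) = ennreal I"
      by (intro nn_integral_has_integral_lebesgue') auto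
    \<comment> \<open>The integrands differ only at t = 0, where \<open>neg_powr\<close> is
      infinite.\<close>
    moreover have "(\<integral>\<^sup>+t. neg_powr \<beta> \<bar>t\<bar> * indicator {0..1} t \<partial>lborel) =
        (\<integral>\<^sup>+t. ennreal (t powr \<beta>) * indicator {0..1} t \<partial>lborel)"
      using AE_lborel_singleton[of "0::real"]
      by (intro nn_integral_cong_AE) (auto simp: neg_powr_def indicator_def elim!: AE_mp)
    ultimately show ?thesis by simp
  qed
  have "(\<integral>\<^sup>+t. neg_powr \<beta> \<bar>t\<bar> * indicator {-1..0} t \<partial>lborel) =
      (\<integral>\<^sup>+t. neg_powr \<beta> \<bar>t\<bar> * indicator {0..1} t \<partial>lborel)"
    by (subst nn_integral_real_affine[where c = "-1" and t = 0])
       (auto simp: indicator_def intro!: nn_integral_cong)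
  then have fin: "(\<integral>\<^sup>+t. neg_powr \<beta> \<bar>t\<bar> * indicator {-1..0} t \<partial>lborel) < \<infinity>"
    using half by (simp only:)
  have "(\<integral>\<^sup>+t. neg_powr \<beta> \<bar>t\<bar> * indicator {-1..1} t \<partial>lborel) \<le>
      (\<integral>\<^sup>+t. neg_powr \<beta> \<bar>t\<bar> * indicator {-1..0} t + neg_powr \<beta> \<bar>t\<bar> * indicator {0..1} t \<partial>lborel)"
    by (intro nn_integral_mono) (auto simp: indicator_def)
  also have "\<dots> = (\<integral>\<^sup>+t. neg_powr \<beta> \<bar>t\<bar> * indicator {-1..0} t \<partial>lborel) +
      (\<integral>\<^sup>+t. neg_powr \<beta> \<bar>t\<bar> * indicator {0..1} t \<partial>lborel)"
    by (rule nn_integral_add) auto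
  also have "\<dots> < \<infinity>"
    using fin half by simp
  finally show ?thesis .
qed

text \<open>
  The maximum of \<open>m\<close> numbers is at least their geometric mean, so the \<open>m\<close>-dimensional singularity
  splits into \<open>m\<close> one-dimensional ones with exponents \<open>\<alpha> / m\<close>.
\<close>

lemma neg_powr_le_prod:
  assumes "finite A" "A \<noteq> {}" "\<alpha> < 0" "\<And>j. j \<in> A \<Longrightarrow> 0 \<le> s j \<and> s j \<le> r"
  shows "neg_powr \<alpha> r \<le> (\<Prod>j\<in>A. neg_powr (\<alpha> / real (card A)) (s j))"
proof (cases "\<exists>j\<in>A. s j = 0")
  case True
  then obtain j where "j \<in> A" "s j = 0" by blast
  \<comment> \<open>An infinite factor makes the product infinite because \<open>neg_powr\<close> is
    never 0; otherwise the convention that 0 times infinity is 0 would interfere.\<close>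
  then have "(\<Prod>j\<in>A. neg_powr (\<alpha> / real (card A)) (s j)) = \<infinity>"
    using assms(1) by (auto simp: ennreal_prod_eq_top neg_powr_def)
  then show ?thesis by simp
next
  case False
  obtain j0 where "j0 \<in> A" using assms(2) by blast
  then have r: "r > 0" using assms(4)[of j0] False by force
  have card: "card A > 0" using assms by (simp add: card_gt_0_iff)
  have "r powr \<alpha> = (r powr (\<alpha> / real (card A))) powr real (card A)"
    using card by (subst powr_powr) simp
  also have "\<dots> = (\<Prod>j\<in>A. r powr (\<alpha> / real (card A)))"
    using r by (subst powr_realpow) simp_all
  also have "\<dots> \<le> (\<Prod>j\<in>A. s j powr (\<alpha> / real (card A)))"
  proof (intro prod_mono conjI)
    fix j assume "j \<in> A"
    have "\<alpha> / real (card A) \<le> 0"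
      using assms(3) card by (simp add: divide_nonpos_pos)
    moreover have "0 < s j" "s j \<le> r"
      using assms(4)[OF \<open>j \<in> A\<close>] False \<open>j \<in> A\<close> by (auto simp: less_le)
    ultimately show "r powr (\<alpha> / real (card A)) \<le> s j powr (\<alpha> / real (card A))"
      by (rule powr_mono2')
  qed auto
  finally have "ennreal (r powr \<alpha>) \<le> (\<Prod>j\<in>A. ennreal (s j powr (\<alpha> / real (card A))))"
    by (simp add: prod_ennreal ennreal_leI)
  then show ?thesis
    using r False by (simp add: neg_powr_def cong: prod.cong)
qed

text \<open>In a frame whose first \<open>n\<close> vectors span the earlier points, projecting them
  out leaves the other d - n coordinates of \<open>y\<close> unchanged, so each of these is at most
  the residual norm in absolute value. The singularity is thus bounded by a product of
  one-dimensional ones with exponent \<alpha> / (d - n) > -1. The frame depends on \<open>x\<close>,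
  but the resulting product of integrals \<open>C\<close> does not.\<close>

lemma nn_integral_neg_powr_residual_bound:
  fixes \<alpha> :: real
  assumes n: "n < DIM('a::euclidean_space)" and \<alpha>: "\<alpha> < 0" "\<alpha> > - real (DIM('a) - n)"
  obtains C where "C < \<infinity>"
    "\<And>x :: nat \<Rightarrow> 'a. (\<integral>\<^sup>+y. neg_powr \<alpha> (norm (residual (x(n := y)) n)) * indicator (cball 0 1) y \<partial>lborel) \<le> C"
proof
  interpret product_sigma_finite "\<lambda>_. lborel :: real measure" by standard
  let ?d = "DIM('a)"
  let ?A = "{n..<?d}"
  define \<beta> where "\<beta> = \<alpha> / real (card ?A)"
  have \<beta>: "- 1 < \<beta>"
    using n \<alpha> by (simp add: \<beta>_def field_simps)
  \<comment> \<open>The ball is enlarged to the cube [-1, 1] in the frame coordinates, so that the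
    bound factorizes; only the coordinates from \<open>n\<close> on carry a singularity.\<close>
  define h where "h j t = (if j \<in> ?A then neg_powr \<beta> \<bar>t\<bar> else 1) * indicator {-1..1::real} t" for j t
  have [measurable]: "h j \<in> borel_measurable borel" for j
    unfolding h_def by measurable
  define C where "C = (\<Prod>j<?d. \<integral>\<^sup>+t. h j t \<partial>lborel)"
  have "(\<integral>\<^sup>+t. h j t \<partial>lborel) < \<infinity>" for j
  proof (cases "j \<in> ?A")
    case True
    then have "h j = (\<lambda>t. neg_powr \<beta> \<bar>t\<bar> * indicator {-1..1} t)"
      by (simp add: h_def fun_eq_iff)
    then show ?thesis using nn_integral_neg_powr_finite[OF \<beta>] by simp
  next
    case False
    then have "h j = indicator {-1..1}"
      by (auto simp: h_def fun_eq_iff)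
    then show ?thesis by simp
  qed
  then show "C < \<infinity>"
    by (auto simp: C_def less_top[symmetric] ennreal_prod_eq_top)
  fix x :: "nat \<Rightarrow> 'a"
  define W where "W = span (x ` {..<n})"
  have "dim W \<le> card (x ` {..<n})"
    unfolding W_def dim_span by (intro dim_le_card') auto
  also have "\<dots> \<le> n"
    using card_image_le[of "{..<n}" x] by simp
  finally obtain e :: "nat \<Rightarrow> 'a" where e: "orthonormal_frame ?d e" "W \<subseteq> span (e ` {..<n})"
    using ex_orthonormal_frame_span[of W n] n by (auto simp: W_def)
  have ee: "e i \<bullet> e j = (if i = j then 1 else 0)" if "i < ?d" "j < ?d" for i j
    using e(1) that by (auto simp: orthonormal_frame_def)
  have q: "gram_schmidt x i \<bullet> e j = 0" if "i < n" "j \<in> ?A" for i j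
  proof -
    have "gram_schmidt x i \<in> span (gram_schmidt x ` {..<n})"
      using that by (intro span_base) auto
    then have "gram_schmidt x i \<in> span (e ` {..<n})"
      using e(2) unfolding span_gram_schmidt W_def by blast
    then show ?thesis
      using that ee n unfolding span_eq_lin_comb by (auto simp: inner_sum_left)
  qed
  have res: "residual (x(n := y)) n \<bullet> e j = y \<bullet> e j" if "j \<in> ?A" for y j
  proof -
    have "gram_schmidt (x(n := y)) i = gram_schmidt x i" if "i < n" for i
      using that by (intro gram_schmidt_cong) auto
    then show ?thesis
      using q that by (simp add: residual_def inner_diff_left inner_sum_left)
  qed
  have norm_e: "norm (e j) = 1" if "j < ?d" for j
    using ee that by (simp add: norm_eq_1)
  have coord: "\<bar>z \<bullet> e j\<bar> \<le> norm z" if "j < ?d" for z j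
    using Cauchy_Schwarz_ineq2[of z "e j"] norm_e[OF that] by simp
  have "(\<integral>\<^sup>+y. neg_powr \<alpha> (norm (residual (x(n := y)) n)) * indicator (cball 0 1) y \<partial>lborel) \<le>
      (\<integral>\<^sup>+y. (\<Prod>j<?d. h j (y \<bullet> e j)) \<partial>lborel)"
  proof (rule nn_integral_mono)
    fix y :: 'a
    have "neg_powr \<alpha> (norm (residual (x(n := y)) n)) \<le> (\<Prod>j\<in>?A. neg_powr \<beta> \<bar>y \<bullet> e j\<bar>)"
      unfolding \<beta>_def
    proof (rule neg_powr_le_prod)
      fix j assume j: "j \<in> ?A"
      then have "\<bar>residual (x(n := y)) n \<bullet> e j\<bar> \<le> norm (residual (x(n := y)) n)"
        by (intro coord) simp
      then show "0 \<le> \<bar>y \<bullet> e j\<bar> \<and> \<bar>y \<bullet> e j\<bar> \<le> norm (residual (x(n := y)) n)"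
        by (simp add: res[OF j])
    qed (use n \<alpha> in auto)
    also have "\<dots> = (\<Prod>j<?d. if j \<in> ?A then neg_powr \<beta> \<bar>y \<bullet> e j\<bar> else 1)"
      by (subst prod.inter_restrict[symmetric]) (auto intro!: prod.cong)
    finally have "neg_powr \<alpha> (norm (residual (x(n := y)) n)) \<le>
      (\<Prod>j<?d. if j \<in> ?A then neg_powr \<beta> \<bar>y \<bullet> e j\<bar> else 1)" .
    moreover have "\<bar>y \<bullet> e j\<bar> \<le> 1" if "y \<in> cball 0 1" "j < ?d" for j
      using coord[OF that(2), of y] that(1) by simp
    then have "indicator {-1..1} (y \<bullet> e j) = (1 :: ennreal)" if "y \<in> cball 0 1" "j < ?d" for j
      using that by (auto simp: indicator_def abs_le_iff)
    ultimately show "neg_powr \<alpha> (norm (residual (x(n := y)) n)) * indicator (cball 0 1) y \<le>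
        (\<Prod>j<?d. h j (y \<bullet> e j))"
      by (cases "y \<in> cball 0 1") (simp_all add: h_def cong: prod.cong_simp)
  qed
  also have "\<dots> = (\<integral>\<^sup>+c. (\<Prod>j<?d. h j (lin_comb ?d e c \<bullet> e j)) \<partial>lborel_fun ?d)"
    by (rule nn_integral_lborel_frame[OF e(1)]) measurable
  also have "\<dots> = (\<integral>\<^sup>+c. (\<Prod>j<?d. h j (c j)) \<partial>lborel_fun ?d)"
  proof (intro nn_integral_cong prod.cong refl)
    fix c :: "nat \<Rightarrow> real" and j assume "j \<in> {..<?d}"
    then have "lin_comb ?d e c \<bullet> e j = (\<Sum>i<?d. if i = j then c i else 0)"
      unfolding inner_sum_left by (intro sum.cong refl) (auto simp: ee)
    then show "h j (lin_comb ?d e c \<bullet> e j) = h j (c j)"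
      using \<open>j \<in> {..<?d}\<close> by simp
  qed
  also have "\<dots> = C"
    unfolding C_def by (rule product_nn_integral_prod) auto
  finally show "(\<integral>\<^sup>+y. neg_powr \<alpha> (norm (residual (x(n := y)) n)) * indicator (cball 0 1) y \<partial>lborel) \<le> C" .
qed

section \<open>Measurability and iterated integration over the points\<close>

lemma measurable_gram_schmidt[measurable]:
  "n \<in> I \<Longrightarrow> {..<n} \<subseteq> I \<Longrightarrow> (\<lambda>x. gram_schmidt x n) \<in> borel_measurable (\<Pi>\<^sub>M i\<in>I. (lborel :: 'a::euclidean_space measure))"
proof (induction n rule: less_induct)
  case (less n)
  have [measurable]: "(\<lambda>x. gram_schmidt x i) \<in> borel_measurable (\<Pi>\<^sub>M i\<in>I. (lborel :: 'a measure))"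
    if "i \<in> {..<n}" for i
    using less.prems that by (intro less.IH) auto
  have [measurable]: "(\<lambda>x. x n) \<in> borel_measurable (\<Pi>\<^sub>M i\<in>I. (lborel :: 'a measure))"
    using less.prems(1) by measurable
  show ?case
    by (subst gram_schmidt.simps) (unfold sgn_div_norm, measurable)
qed

lemma measurable_residual[measurable]:
  assumes "n < k"
  shows "(\<lambda>x. residual x n) \<in> borel_measurable (lborel_fun k :: (nat \<Rightarrow> 'a::euclidean_space) measure)"
proof -
  have [measurable]: "(\<lambda>x. gram_schmidt x i) \<in> borel_measurable (lborel_fun k :: (nat \<Rightarrow> 'a::euclidean_space) measure)"
    if "i \<in> {..<n}" for i
    using assms that by (intro measurable_gram_schmidt) auto
  have [measurable]: "(\<lambda>x. x n) \<in> borel_measurable (lborel_fun k :: (nat \<Rightarrow> 'a) measure)"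
    using assms by simp
  show ?thesis
    unfolding residual_def by measurable
qed

lemma measurable_neg_powr_residual:
  assumes "i < k"
  shows "(\<lambda>x. neg_powr \<alpha> (norm (residual x i)) * indicator (cball 0 1) (x i)) \<in>
         borel_measurable (lborel_fun k :: (nat \<Rightarrow> 'a::euclidean_space) measure)"
proof -
  have [measurable]: "(\<lambda>x. x i) \<in> borel_measurable (lborel_fun k :: (nat \<Rightarrow> 'a) measure)"
    "cball 0 1 \<in> sets (borel :: 'a measure)"
    using assms by simp_all
  note [measurable] = measurable_residual[OF assms]
  show ?thesis by measurable
qed

lemma measurable_prod_neg_powr_residual:
  "(\<lambda>x. \<Prod>i<k. neg_powr \<alpha> (norm (residual x i)) * indicator (cball 0 1) (x i)) \<in>
   borel_measurable (lborel_fun k :: (nat \<Rightarrow> 'a::euclidean_space) measure)"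
  by (intro borel_measurable_prod_ennreal measurable_neg_powr_residual) auto

text \<open>The last point is integrated first and costs the constant factor \<open>C\<close>. The
  condition on \<alpha> is the one for the last point; it weakens as \<open>K\<close> decreases and
  therefore passes to the induction hypothesis.\<close>

lemma nn_integral_prod_neg_powr_residual_finite:
  fixes \<alpha> :: real
  assumes "K \<le> DIM('a::euclidean_space)" "\<alpha> < 0" "\<alpha> > - real (DIM('a) + 1 - K)"
  shows "(\<integral>\<^sup>+x. (\<Prod>i<K. neg_powr \<alpha> (norm (residual x i)) * indicator (cball 0 1) (x i))
    \<partial>(lborel_fun K :: (nat \<Rightarrow> 'a) measure)) < \<infinity>"
  using assms
proof (induction K)
  case 0
  then show ?case by (simp add: space_PiM)
next
  case (Suc K)
  interpret product_sigma_finite "\<lambda>_. lborel :: 'a measure" by standard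
  let ?w = "\<lambda>x i. neg_powr \<alpha> (norm (residual x i)) * indicator (cball 0 1) (x i :: 'a)"
  obtain C where C: "C < \<infinity>"
    "\<And>x :: nat \<Rightarrow> 'a. (\<integral>\<^sup>+y. neg_powr \<alpha> (norm (residual (x(K := y)) K)) * indicator (cball 0 1) y \<partial>lborel) \<le> C"
    using nn_integral_neg_powr_residual_bound[where 'a = 'a and n = K and \<alpha> = \<alpha>] Suc.prems by (auto simp: Suc_diff_le)
  have "(\<integral>\<^sup>+x. (\<Prod>i<Suc K. ?w x i) \<partial>lborel_fun (Suc K)) =
      (\<integral>\<^sup>+x. (\<integral>\<^sup>+y. (\<Prod>i<Suc K. ?w (x(K := y)) i) \<partial>lborel) \<partial>lborel_fun K)"
    unfolding lessThan_Suc
    by (rule product_nn_integral_insert)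
       (use measurable_prod_neg_powr_residual[of \<alpha> "Suc K"] in \<open>auto simp: lessThan_Suc\<close>)
  also have "\<dots> = (\<integral>\<^sup>+x. (\<integral>\<^sup>+y. (\<Prod>i<K. ?w x i) * ?w (x(K := y)) K \<partial>lborel) \<partial>lborel_fun K)"
  proof (intro nn_integral_cong)
    fix x and y :: 'a
    have "(\<Prod>i<K. ?w (x(K := y)) i) = (\<Prod>i<K. ?w x i)"
    proof (intro prod.cong refl)
      fix i assume "i \<in> {..<K}"
      then have "residual (x(K := y)) i = residual x i"
        by (intro residual_cong) auto
      then show "?w (x(K := y)) i = ?w x i"
        using \<open>i \<in> {..<K}\<close> by simp
    qed
    then show "(\<Prod>i<Suc K. ?w (x(K := y)) i) = (\<Prod>i<K. ?w x i) * ?w (x(K := y)) K"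
      by simp
  qed
  also have "\<dots> \<le> (\<integral>\<^sup>+x. (\<Prod>i<K. ?w x i) * C \<partial>lborel_fun K)"
  proof (rule nn_integral_mono)
    fix x :: "nat \<Rightarrow> 'a" assume x: "x \<in> space (lborel_fun K)"
    have "(\<lambda>y. x(K := y)) \<in> lborel \<rightarrow>\<^sub>M lborel_fun (Suc K)"
      unfolding lessThan_Suc using x by (intro measurable_component_update) auto
    from measurable_compose[OF this measurable_neg_powr_residual[of K "Suc K" \<alpha>]]
    have [measurable]: "(\<lambda>y. ?w (x(K := y)) K) \<in> borel_measurable lborel"
      by simp
    have "(\<integral>\<^sup>+y. (\<Prod>i<K. ?w x i) * ?w (x(K := y)) K \<partial>lborel) =
        (\<Prod>i<K. ?w x i) * (\<integral>\<^sup>+y. ?w (x(K := y)) K \<partial>lborel)"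
      by (rule nn_integral_cmult) measurable
    also have "\<dots> \<le> (\<Prod>i<K. ?w x i) * C"
      using C(2)[of x] by (intro mult_left_mono) auto
    finally show "(\<integral>\<^sup>+y. (\<Prod>i<K. ?w x i) * ?w (x(K := y)) K \<partial>lborel) \<le> (\<Prod>i<K. ?w x i) * C" .
  qed
  also have "\<dots> = (\<integral>\<^sup>+x. (\<Prod>i<K. ?w x i) \<partial>lborel_fun K) * C"
    by (rule nn_integral_multc[OF measurable_prod_neg_powr_residual])
  also have "\<dots> < \<infinity>"
    using Suc.IH Suc.prems C(1) by (auto simp: ennreal_mult_less_top)
  finally show ?case .
qed

section \<open>Moments and factorization of the covariance\<close>

text \<open>The common form of both factors of \<open>mu\<close>, with the points other than the
  origin numbered from 0.\<close>

definition simplex_weight :: "nat \<Rightarrow> real \<Rightarrow> (nat \<Rightarrow> 'a::euclidean_space) \<Rightarrow> real" where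
  "simplex_weight k \<alpha> x = simplex_Delta_power 1 \<alpha> (0 # map x [0..<k])"

lemma simplex_weight_nonneg: "0 \<le> simplex_weight k \<alpha> x"
  by (simp add: simplex_weight_def simplex_Delta_power_def)

text \<open>This trades the choice in \<open>flat_volume\<close> for an expression whose
  measurability is evident. The norms appear as the edges at the origin. If k > d, the exponent is 0
  and only the edge condition remains.\<close>

lemma simplex_weight_eq:
  fixes x :: "nat \<Rightarrow> 'a::euclidean_space"
  assumes "k \<le> DIM('a) \<or> \<alpha> = 0"
  shows "simplex_weight k \<alpha> x =
    (if (\<forall>i\<in>{..<k}. norm (x i) \<le> 1) \<and> (\<forall>i\<in>{..<k}. \<forall>j\<in>{..<k}. norm (x i - x j) \<le> 1)
     then if \<alpha> = 0 then 1 else ((\<Prod>i<k. norm (residual x i)) / fact k) powr \<alpha> else 0)"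
proof -
  have set: "set (0 # map x [0..<k]) = insert 0 (x ` {..<k})"
    by (simp add: atLeast0LessThan)
  have "edges_le 1 (0 # map x [0..<k]) \<longleftrightarrow>
      (\<forall>i\<in>{..<k}. norm (x i) \<le> 1) \<and> (\<forall>i\<in>{..<k}. \<forall>j\<in>{..<k}. norm (x i - x j) \<le> 1)"
    unfolding edges_le_def set by auto
  moreover have "simplex_Delta 1 (0 # map x [0..<k]) = (\<Prod>i<k. norm (residual x i)) / fact k"
    if "edges_le 1 (0 # map x [0..<k])" "\<alpha> \<noteq> 0"
    using that assms by (simp add: simplex_Delta_def set[simplified] flat_volume_simplex)
  ultimately show ?thesis
    by (simp add: simplex_weight_def simplex_Delta_power_def)
qed

lemma measurable_simplex_weight:
  assumes "k \<le> DIM('a::euclidean_space) \<or> \<alpha> = 0"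
  shows "simplex_weight k \<alpha> \<in> borel_measurable (lborel_fun k :: (nat \<Rightarrow> 'a) measure)"
proof -
  have [measurable]: "(\<lambda>x. residual x i) \<in> borel_measurable (lborel_fun k :: (nat \<Rightarrow> 'a) measure)"
    if "i \<in> {..<k}" for i
    using that by (intro measurable_residual) auto
  have "(\<lambda>x :: nat \<Rightarrow> 'a. simplex_weight k \<alpha> x) \<in> borel_measurable (lborel_fun k)"
    unfolding simplex_weight_eq[OF assms] by measurable
  then show ?thesis by simp
qed

lemma measurable_prod_indicator_cball[measurable]:
  "(\<lambda>x. \<Prod>i<k. indicator (cball 0 1) (x i) :: ennreal) \<in>
   borel_measurable (lborel_fun k :: (nat \<Rightarrow> 'a::euclidean_space) measure)"
proof (intro borel_measurable_prod_ennreal)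
  fix i assume "i \<in> {..<k}"
  then have [measurable]: "(\<lambda>x. x i) \<in> borel_measurable (lborel_fun k :: (nat \<Rightarrow> 'a) measure)"
    by simp
  have [measurable]: "cball 0 1 \<in> sets (borel :: 'a measure)" by simp
  show "(\<lambda>x. indicator (cball 0 1) (x i) :: ennreal) \<in> borel_measurable (lborel_fun k :: (nat \<Rightarrow> 'a) measure)"
    by measurable
qed

text \<open>The factor I(k, \<alpha>) of the overview, as an extended nonnegative number, so that it
  can be handled before its finiteness is known.\<close>

definition simplex_moment :: "'a::euclidean_space itself \<Rightarrow> nat \<Rightarrow> real \<Rightarrow> ennreal" where
  "simplex_moment _ k \<alpha> =
    (\<integral>\<^sup>+x. ennreal (simplex_weight k \<alpha> x) * (\<Prod>i<k. indicator (cball 0 1) (x i)) \<partial>(lborel_fun k :: (nat \<Rightarrow> 'a) measure))"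

lemma norm_residual_le:
  fixes x :: "nat \<Rightarrow> 'a::euclidean_space"
  shows "norm (residual x i) \<le> norm (x i)"
proof -
  have "norm (residual x i) \<le> norm (x i) * norm (gram_schmidt x i)"
    using norm_cauchy_schwarz[of "x i" "gram_schmidt x i"] by (simp add: inner_gram_schmidt(1))
  also have "\<dots> \<le> norm (x i) * 1"
    by (intro mult_left_mono) (auto simp: gram_schmidt_eq[of x i] norm_sgn)
  finally show ?thesis by simp
qed

text \<open>For \<alpha> < 0 the power of the volume splits into powers of the residual norms, and
  the singular integral applies. For \<alpha> \<ge> 0 residuals are no longer than the points, so
  the weight is at most 1 and the moment at most the k-th power of the volume of the ball.\<close>

lemma simplex_moment_finite:
  assumes "k \<le> DIM('a::euclidean_space) \<or> \<alpha> = 0" and "\<alpha> > - real DIM('a) + real k - 1"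
  shows "simplex_moment TYPE('a) k \<alpha> < \<infinity>"
proof (cases "\<alpha> < 0")
  case True
  then have k: "k \<le> DIM('a)" using assms by auto
  let ?C = "ennreal (inverse (fact k) powr \<alpha>)"
  have "simplex_moment TYPE('a) k \<alpha> \<le> (\<integral>\<^sup>+x. ?C *
      (\<Prod>i<k. neg_powr \<alpha> (norm (residual x i)) * indicator (cball 0 1) (x i))
        \<partial>(lborel_fun k :: (nat \<Rightarrow> 'a) measure))"
    unfolding simplex_moment_def
  proof (rule nn_integral_mono)
    fix x :: "nat \<Rightarrow> 'a"
    have "simplex_weight k \<alpha> x \<le> ((\<Prod>i<k. norm (residual x i)) / fact k) powr \<alpha>"
      using True by (simp add: simplex_weight_eq[OF assms(1)])
    also have "\<dots> = inverse (fact k) powr \<alpha> * (\<Prod>i<k. norm (residual x i) powr \<alpha>)"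
      by (simp add: divide_inverse powr_mult prod_nonneg prod_powr_distrib mult.commute)
    finally have "ennreal (simplex_weight k \<alpha> x) \<le> ?C * (\<Prod>i<k. ennreal (norm (residual x i) powr \<alpha>))"
      by (simp add: prod_ennreal ennreal_mult[symmetric] prod_nonneg ennreal_leI)
    also have "\<dots> \<le> ?C * (\<Prod>i<k. neg_powr \<alpha> (norm (residual x i)))"
      by (intro mult_left_mono prod_mono_ennreal) (auto simp: neg_powr_def)
    finally show "ennreal (simplex_weight k \<alpha> x) * (\<Prod>i<k. indicator (cball 0 1) (x i)) \<le>
        ?C * (\<Prod>i<k. neg_powr \<alpha> (norm (residual x i)) * indicator (cball 0 1) (x i))"
      by (simp add: prod.distrib mult_right_mono mult.assoc[symmetric])
  qed
  also have "\<dots> = ?C * (\<integral>\<^sup>+x. (\<Prod>i<k. neg_powr \<alpha> (norm (residual x i)) * indicator (cball 0 1) (x i))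
        \<partial>(lborel_fun k :: (nat \<Rightarrow> 'a) measure))"
    by (rule nn_integral_cmult[OF measurable_prod_neg_powr_residual])
  also have "\<dots> < \<infinity>"
    using nn_integral_prod_neg_powr_residual_finite[where 'a = 'a and K = k and \<alpha> = \<alpha>] k True assms(2)
    by (simp add: ennreal_mult_less_top of_nat_diff)
  finally show ?thesis .
next
  case False
  interpret product_sigma_finite "\<lambda>_. lborel :: 'a measure" by standard
  have "simplex_moment TYPE('a) k \<alpha> \<le> (\<integral>\<^sup>+x. (\<Prod>i<k. indicator (cball 0 1) (x i))
        \<partial>(lborel_fun k :: (nat \<Rightarrow> 'a) measure))"
    unfolding simplex_moment_def
  proof (rule nn_integral_mono)
    fix x :: "nat \<Rightarrow> 'a"
    have "simplex_weight k \<alpha> x \<le> 1"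
    proof (cases "\<alpha> = 0 \<or> (\<exists>i<k. norm (x i) > 1)")
      case True
      then show ?thesis by (force simp: simplex_weight_eq[OF assms(1)])
    next
      case F: False
      then have "norm (residual x i) \<le> 1" if "i < k" for i
        using norm_residual_le[of x i] that by force
      then have "(\<Prod>i<k. norm (residual x i)) \<le> 1"
        by (intro prod_le_1) auto
      then have "(\<Prod>i<k. norm (residual x i)) / fact k \<le> 1"
        by (simp add: divide_le_eq order_trans[OF _ fact_ge_1])
      then have "((\<Prod>i<k. norm (residual x i)) / fact k) powr \<alpha> \<le> 1 powr \<alpha>"
        using \<open>\<not> \<alpha> < 0\<close> by (intro powr_mono2) (auto simp: prod_nonneg)
      then show ?thesis by (simp add: simplex_weight_eq[OF assms(1)])
    qed
    then have "ennreal (simplex_weight k \<alpha> x) * (\<Prod>i<k. indicator (cball 0 1) (x i)) \<le>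
        1 * (\<Prod>i<k. indicator (cball 0 1) (x i))"
      by (intro mult_right_mono) auto
    then show "ennreal (simplex_weight k \<alpha> x) * (\<Prod>i<k. indicator (cball 0 1) (x i)) \<le>
        (\<Prod>i<k. indicator (cball 0 1) (x i))"
      by simp
  qed
  also have "\<dots> = (\<Prod>i<k. emeasure (lborel :: 'a measure) (cball 0 1))"
    by (subst product_nn_integral_prod) (auto intro!: borel_measurable_indicator)
  also have "\<dots> < \<infinity>"
    using emeasure_lborel_cball_finite[of "0::'a" 1] by (simp add: power_less_top_ennreal)
  finally show ?thesis .
qed

text \<open>A function with finite integral is finite almost everywhere, and the singular product is
  infinite at degenerate points of the ball. Any exponent in (-1, 0) would do: for k \<le> d the
  codimension is at least 1 at every step.\<close>

lemma AE_residual_nonzero: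
  assumes "k \<le> DIM('a::euclidean_space)"
  shows "AE x in (lborel_fun k :: (nat \<Rightarrow> 'a) measure).
    (\<forall>i<k. x i \<in> cball 0 1) \<longrightarrow> (\<forall>i<k. residual x i \<noteq> 0)"
proof -
  let ?w = "\<lambda>x :: nat \<Rightarrow> 'a. \<Prod>i<k. neg_powr (- 1 / 2) (norm (residual x i)) * indicator (cball 0 1) (x i)"
  have "(\<integral>\<^sup>+x. ?w x \<partial>lborel_fun k) < \<infinity>"
    using assms by (intro nn_integral_prod_neg_powr_residual_finite) auto
  then have "AE x in lborel_fun k. ?w x \<noteq> \<infinity>"
    using measurable_prod_neg_powr_residual by (intro nn_integral_noteq_infinite) (auto simp: less_top)
  then show ?thesis
  proof (rule AE_mp, intro AE_I2 impI allI notI)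
    fix x :: "nat \<Rightarrow> 'a" and i
    assume *: "?w x \<noteq> \<infinity>" "\<forall>i<k. x i \<in> cball 0 1" "i < k" "residual x i = 0"
    have "?w x = (\<Prod>i<k. neg_powr (- 1 / 2) (norm (residual x i)))"
      using *(2) by (intro prod.cong) auto
    also have "\<dots> = \<infinity>"
      using *(3,4) by (auto simp: ennreal_prod_eq_top neg_powr_def)
    finally show False using *(1) by simp
  qed
qed

text \<open>Points of the ball of radius 1/2 have mutual distances at most 1 and are almost surely
  nondegenerate, so the weight is positive almost everywhere on a product of such balls. A zero
  moment would make this product a null set.\<close>

lemma simplex_moment_pos:
  assumes "k \<le> DIM('a::euclidean_space) \<or> \<alpha> = 0"
  shows "simplex_moment TYPE('a) k \<alpha> > 0"
proof (rule ccontr)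
  interpret product_sigma_finite "\<lambda>_. lborel :: 'a measure" by standard
  have [measurable]: "simplex_weight k \<alpha> \<in> borel_measurable (lborel_fun k :: (nat \<Rightarrow> 'a) measure)"
    by (rule measurable_simplex_weight[OF assms])
  assume "\<not> simplex_moment TYPE('a) k \<alpha> > 0"
  then have "simplex_moment TYPE('a) k \<alpha> = 0" by simp
  then have "AE x in (lborel_fun k :: (nat \<Rightarrow> 'a) measure).
      ennreal (simplex_weight k \<alpha> x) * (\<Prod>i<k. indicator (cball 0 1) (x i)) = 0"
    unfolding simplex_moment_def by (subst (asm) nn_integral_0_iff_AE) auto
  moreover have "AE x in (lborel_fun k :: (nat \<Rightarrow> 'a) measure).
      (\<forall>i<k. x i \<in> cball 0 1) \<longrightarrow> \<alpha> = 0 \<or> (\<forall>i<k. residual x i \<noteq> 0)"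
    using AE_residual_nonzero[where 'a = 'a and k = k] assms by (cases "\<alpha> = 0") auto
  ultimately have "AE x in (lborel_fun k :: (nat \<Rightarrow> 'a) measure). x \<notin> (\<Pi>\<^sub>E i\<in>{..<k}. cball 0 (1/2))"
  proof (eventually_elim, intro notI)
    fix x :: "nat \<Rightarrow> 'a"
    assume *: "ennreal (simplex_weight k \<alpha> x) * (\<Prod>i<k. indicator (cball 0 1) (x i)) = 0"
      "(\<forall>i<k. x i \<in> cball 0 1) \<longrightarrow> \<alpha> = 0 \<or> (\<forall>i<k. residual x i \<noteq> 0)"
      "x \<in> (\<Pi>\<^sub>E i\<in>{..<k}. cball 0 (1/2))"
    have half: "norm (x i) \<le> 1/2" if "i < k" for i
      using *(3) that by (auto simp: PiE_iff)
    then have one: "norm (x i) \<le> 1" if "i < k" for i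
      using that by force
    have edge: "norm (x i - x j) \<le> 1" if "i < k" "j < k" for i j
      using norm_triangle_ineq4[of "x i" "x j"] half[OF that(1)] half[OF that(2)] by simp
    have "simplex_weight k \<alpha> x > 0"
      using one edge *(2) by (auto simp: simplex_weight_eq[OF assms])
    moreover have "(\<Prod>i<k. indicator (cball 0 1) (x i)) = (1 :: ennreal)"
      using one by (intro prod.neutral) auto
    ultimately show False
      using *(1) by simp
  qed
  then have "emeasure (lborel_fun k) (\<Pi>\<^sub>E i\<in>{..<k}. cball (0::'a) (1/2)) = 0"
    by (subst (asm) AE_iff_null_sets[symmetric]) (auto intro!: sets_PiM_I_finite)
  then have "(\<Prod>i<k. emeasure lborel (cball (0::'a) (1/2))) = 0"
    by (subst (asm) emeasure_PiM) auto
  moreover have "emeasure lborel (cball (0::'a) (1/2)) \<noteq> 0"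
    using content_cball_pos[of "1/2" "0::'a"] by (auto simp: measure_def)
  ultimately show False by simp
qed

text \<open>For m = 1 the second list starts at index k1 + 1, so the two factors depend on the
  disjoint blocks read off by \<open>u\<close> and \<open>v\<close>. The integrand is nonnegative,
  so the Bochner integral is \<open>enn2real\<close> of a nonnegative integral, to which Fubini
  applies without integrability; \<open>enn2real\<close> is multiplicative.\<close>

lemma mu_factorization:
  fixes \<alpha>1 \<alpha>2 :: real
  assumes "k1 \<le> DIM('a::euclidean_space) \<or> \<alpha>1 = 0" "k2 \<le> DIM('a) \<or> \<alpha>2 = 0"
  shows "mu TYPE('a) k1 k2 1 \<alpha>1 \<alpha>2 =
         enn2real (simplex_moment TYPE('a) k1 \<alpha>1) * enn2real (simplex_moment TYPE('a) k2 \<alpha>2)"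
proof -
  interpret product_sigma_finite "\<lambda>_. lborel :: 'a measure" by standard
  let ?I = "{1..k1}" and ?J = "{k1 + 1..k1 + k2}"
  let ?MI = "\<Pi>\<^sub>M i\<in>?I. (lborel :: 'a measure)" and ?MJ = "\<Pi>\<^sub>M i\<in>?J. (lborel :: 'a measure)"
  let ?M = "\<Pi>\<^sub>M i\<in>?I \<union> ?J. (lborel :: 'a measure)"
  define G where "G k \<alpha> x = ennreal (simplex_weight k \<alpha> x) * (\<Prod>i<k. indicator (cball 0 1) (x i))"
    for k \<alpha> and x :: "nat \<Rightarrow> 'a"
  define u v :: "(nat \<Rightarrow> 'a) \<Rightarrow> nat \<Rightarrow> 'a" where "u x = (\<lambda>i\<in>{..<k1}. x (i + 1))"
    and "v x = (\<lambda>i\<in>{..<k2}. x (i + (k1 + 1)))" for x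
  have [measurable]: "simplex_weight k1 \<alpha>1 \<in> borel_measurable (lborel_fun k1 :: (nat \<Rightarrow> 'a) measure)"
    "simplex_weight k2 \<alpha>2 \<in> borel_measurable (lborel_fun k2 :: (nat \<Rightarrow> 'a) measure)"
    using assms by (auto intro!: measurable_simplex_weight)
  have G[measurable]: "G k1 \<alpha>1 \<in> borel_measurable (lborel_fun k1)" "G k2 \<alpha>2 \<in> borel_measurable (lborel_fun k2)"
    unfolding G_def by measurable
  have u[measurable]: "u \<in> ?M \<rightarrow>\<^sub>M lborel_fun k1" "u \<in> ?MI \<rightarrow>\<^sub>M lborel_fun k1"
    and v[measurable]: "v \<in> ?M \<rightarrow>\<^sub>M lborel_fun k2" "v \<in> ?MJ \<rightarrow>\<^sub>M lborel_fun k2"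
    unfolding u_def[abs_def] v_def[abs_def]
    by (auto intro!: measurable_restrict measurable_component_singleton)
  have IJ: "{1..k1 + k2} = ?I \<union> ?J" "?I \<inter> ?J = {}" by auto
  let ?f = "\<lambda>x. simplex_Delta_power 1 \<alpha>1 (0 # map x [1..<k1 + 1]) *
       simplex_Delta_power 1 \<alpha>2 (0 # map x [k1 + 1..<k1 + k2 + 1])"
  have f: "?f x = simplex_weight k1 \<alpha>1 (u x) * simplex_weight k2 \<alpha>2 (v x)" for x
  proof -
    have "map x [1..<k1 + 1] = map (u x) [0..<k1]" "map x [k1 + 1..<k1 + k2 + 1] = map (v x) [0..<k2]"
      by (auto simp: u_def v_def add.commute intro!: nth_equalityI simp del: upt_Suc)
    then show ?thesis by (simp only: simplex_weight_def)
  qed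
  have shift: "{m + 1..m + k} = (\<lambda>i. i + (m + 1)) ` {..<k}" for m k :: nat
    unfolding lessThan_atLeast0 image_add_atLeastLessThan' by auto
  then have bij: "bij_betw (\<lambda>i. i + (m + 1)) {..<k} {m + 1..m + k}" for m k :: nat
    by (simp add: bij_betw_def inj_on_def)
  have ind: "x \<in> {1..k1 + k2} \<rightarrow>\<^sub>E cball 0 1 \<longleftrightarrow> (\<forall>i<k1. u x i \<in> cball 0 1) \<and> (\<forall>i<k2. v x i \<in> cball 0 1)"
    if "x \<in> space ?M" for x
  proof -
    have "(\<forall>i\<in>?I. P i) \<longleftrightarrow> (\<forall>i<k1. P (i + 1))" "(\<forall>i\<in>?J. P i) \<longleftrightarrow> (\<forall>i<k2. P (i + (k1 + 1)))" for P
      using shift[of 0 k1] shift[of k1 k2] by auto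
    then show ?thesis
      using that unfolding IJ(1) by (auto simp: PiE_iff space_PiM u_def v_def ball_Un)
  qed
  have prod_ind: "(\<Prod>i<k. indicator (cball 0 1) (y i)) = (if \<forall>i<k. y i \<in> cball 0 1 then 1 else (0::ennreal))"
    for k and y :: "nat \<Rightarrow> 'a"
    by (auto simp: indicator_def intro!: prod_zero prod.neutral)
  have "mu TYPE('a) k1 k2 1 \<alpha>1 \<alpha>2 =
      (\<integral>x. indicator ({1..k1 + k2} \<rightarrow>\<^sub>E cball 0 1) x *\<^sub>R ?f x \<partial>?M)"
    unfolding mu_def set_lebesgue_integral_def IJ(1)[symmetric] by simp
  also have "\<dots> = (\<integral>x. enn2real (G k1 \<alpha>1 (u x) * G k2 \<alpha>2 (v x)) \<partial>?M)"
  proof (rule Bochner_Integration.integral_cong[OF refl])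
    fix x assume "x \<in> space ?M"
    then show "indicator ({1..k1 + k2} \<rightarrow>\<^sub>E cball 0 1) x *\<^sub>R ?f x = enn2real (G k1 \<alpha>1 (u x) * G k2 \<alpha>2 (v x))"
      unfolding f G_def prod_ind using ind[of x]
      by (simp add: indicator_def enn2real_mult simplex_weight_nonneg)
  qed
  also have "\<dots> = enn2real (\<integral>\<^sup>+x. G k1 \<alpha>1 (u x) * G k2 \<alpha>2 (v x) \<partial>?M)"
  proof (subst integral_eq_nn_integral)
    show "(\<lambda>x. enn2real (G k1 \<alpha>1 (u x) * G k2 \<alpha>2 (v x))) \<in> borel_measurable ?M"
      by measurable
    have "G k \<alpha> y < \<infinity>" for k \<alpha> y
      by (simp add: G_def prod_ind)
    then have "ennreal (enn2real (G k1 \<alpha>1 (u x) * G k2 \<alpha>2 (v x))) = G k1 \<alpha>1 (u x) * G k2 \<alpha>2 (v x)" for x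
      by (intro ennreal_enn2real) (simp add: ennreal_mult_less_top)
    then show "enn2real (\<integral>\<^sup>+x. ennreal (enn2real (G k1 \<alpha>1 (u x) * G k2 \<alpha>2 (v x))) \<partial>?M) =
        enn2real (\<integral>\<^sup>+x. G k1 \<alpha>1 (u x) * G k2 \<alpha>2 (v x) \<partial>?M)"
      by simp
  qed auto
  also have "(\<integral>\<^sup>+x. G k1 \<alpha>1 (u x) * G k2 \<alpha>2 (v x) \<partial>?M) =
      (\<integral>\<^sup>+x. (\<integral>\<^sup>+y. G k1 \<alpha>1 (u (merge ?I ?J (x, y))) * G k2 \<alpha>2 (v (merge ?I ?J (x, y))) \<partial>?MJ) \<partial>?MI)"
    by (rule product_nn_integral_fold[OF IJ(2)]) (rule finite_atLeastAtMost, rule finite_atLeastAtMost, measurable)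
  also have "\<dots> = (\<integral>\<^sup>+x. (\<integral>\<^sup>+y. G k1 \<alpha>1 (u x) * G k2 \<alpha>2 (v y) \<partial>?MJ) \<partial>?MI)"
  proof (intro nn_integral_cong arg_cong2[of _ _ _ _ times])
    fix x y :: "nat \<Rightarrow> 'a"
    have "u (merge ?I ?J (x, y)) = u x" "v (merge ?I ?J (x, y)) = v y"
      by (auto simp: u_def v_def merge_def fun_eq_iff)
    then show "G k1 \<alpha>1 (u (merge ?I ?J (x, y))) = G k1 \<alpha>1 (u x)"
      "G k2 \<alpha>2 (v (merge ?I ?J (x, y))) = G k2 \<alpha>2 (v y)"
      by simp_all
  qed
  also have "\<dots> = (\<integral>\<^sup>+x. G k1 \<alpha>1 (u x) \<partial>?MI) * (\<integral>\<^sup>+y. G k2 \<alpha>2 (v y) \<partial>?MJ)"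
  proof -
    have Gu: "(\<lambda>x. G k1 \<alpha>1 (u x)) \<in> borel_measurable ?MI" and Gv: "(\<lambda>y. G k2 \<alpha>2 (v y)) \<in> borel_measurable ?MJ"
      by measurable
    show ?thesis
      by (simp only: nn_integral_cmult[OF Gv] nn_integral_multc[OF Gu])
  qed
  also have "(\<integral>\<^sup>+x. G k1 \<alpha>1 (u x) \<partial>?MI) = simplex_moment TYPE('a) k1 \<alpha>1"
    unfolding simplex_moment_def u_def G_def[symmetric]
    by (rule nn_integral_PiM_lborel_reindex) (use bij[of 0 k1] in auto)
  also have "(\<integral>\<^sup>+y. G k2 \<alpha>2 (v y) \<partial>?MJ) = simplex_moment TYPE('a) k2 \<alpha>2"
    unfolding simplex_moment_def v_def G_def[symmetric]
    by (rule nn_integral_PiM_lborel_reindex[OF bij]) auto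
  finally show ?thesis by (simp add: enn2real_mult)
qed

section \<open>Rank-one matrices and the covariance matrix\<close>

text \<open>Everything follows from \<open>A *v x = (a \<bullet> x) *\<^sub>R a\<close>: the range
  is the line through \<open>a\<close>, and the quadratic form is the square of
  \<open>a \<bullet> x\<close>.\<close>

lemma rank_one_matrix:
  fixes a :: "real^'n" and A :: "real^'n^'n"
  assumes "a \<noteq> 0" "A = (\<chi> i j. a $ i * a $ j)" "CARD('n) \<ge> 2"
  shows "rank A = 1" "det A = 0" "positive_semidefinite A" "\<not> positive_definite A"
proof -
  have Av: "A *v x = (a \<bullet> x) *\<^sub>R a" for x
    by (simp add: assms(2) vec_eq_iff matrix_vector_mult_def inner_vec_def sum_distrib_left sum_distrib_right mult_ac)
  have "range (\<lambda>x. A *v x) = span {a}"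
  proof
    show "span {a} \<subseteq> range (\<lambda>x. A *v x)"
    proof
      fix y assume "y \<in> span {a}"
      then obtain t where "y = t *\<^sub>R a" by (auto simp: span_singleton)
      then have "y = A *v ((t / (a \<bullet> a)) *\<^sub>R a)"
        using assms(1) by (simp add: Av)
      then show "y \<in> range (\<lambda>x. A *v x)" by blast
    qed
  qed (auto simp: Av span_singleton)
  then show rank: "rank A = 1"
    using assms(1) by (simp add: rank_dim_range dim_singleton)
  show "det A = 0"
    using rank assms(3) by (simp add: det_eq_0_rank)
  have sym: "transpose A = A"
    by (simp add: assms(2) transpose_def vec_eq_iff mult.commute)
  show "positive_semidefinite A"
    unfolding positive_semidefinite_def by (simp add: sym Av inner_commute)
  \<comment> \<open>In dimension at least 2 some nonzero vector is orthogonal to \<open>a\<close>;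
    the quadratic form vanishes there.\<close>
  have "dim (span {a}) < DIM(real^'n)"
    using assms by simp
  then obtain x where x: "x \<noteq> 0" "\<And>y. y \<in> span {a} \<Longrightarrow> orthogonal x y"
    using orthogonal_to_subspace_exists by (metis dim_span)
  then have "x \<bullet> (A *v x) = 0"
    using x(2)[of a] by (simp add: Av orthogonal_def span_base)
  then show "\<not> positive_definite A"
    using x(1) by (auto simp: positive_definite_def)
qed

theorem corollary5p2:
  fixes k :: "'n::{finite,linorder} \<Rightarrow> nat" and \<alpha> :: "'n \<Rightarrow> real"
  assumes "CARD('n) \<ge> 2"
    and "admissible DIM('a::euclidean_space) k \<alpha>"
  shows "rank (supercritical_cov TYPE('a) k \<alpha>) = 1 \<and>
         det (supercritical_cov TYPE('a) k \<alpha>) = 0 \<and>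
         (positive_semidefinite (supercritical_cov TYPE('a) k \<alpha>) \<and>
          \<not> positive_definite (supercritical_cov TYPE('a) k \<alpha>))"
proof -
  have dim: "k i \<le> DIM('a) \<or> \<alpha> i = 0" and bound: "\<alpha> i > - real DIM('a) + real (k i) - 1" for i
    using assms(2) by (auto simp: admissible_def not_le[symmetric])
  define a :: "real^'n::{finite,linorder}" where "a = (\<chi> i. enn2real (simplex_moment TYPE('a) (k i) (\<alpha> i)) / fact (k i))"
  \<comment> \<open>Both bounds enter: \<open>enn2real\<close> is positive exactly between 0 and
    infinity.\<close>
  have "a $ i > 0" for i
    using simplex_moment_pos[OF dim] simplex_moment_finite[OF dim bound]
    by (simp add: a_def enn2real_positive_iff)
  then have "a \<noteq> 0" by (metis less_irrefl zero_index)
  moreover have "supercritical_cov TYPE('a) k \<alpha> = (\<chi> i j. a $ i * a $ j)"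
    by (simp add: supercritical_cov_def a_def mu_factorization[OF dim dim, unfolded One_nat_def])
  ultimately show ?thesis
    using rank_one_matrix[of a] assms(1) by blast
qed

end
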